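(* Let $F_0\in\mathbb F_{\mathcal X}$, let $\phi$ be a weight function, and suppose that one of the following two sets of assumptions holds. (A) $\mathcal X$ is a Stonean vector lattice, i.e. $X\wedge Y,\ X\vee Y\in\mathcal X$ for all $X,Y\in\mathcal X$; $\rho:\mathcal X\to\mathbb R$ is a law-invariant coherent risk measure with associated distortion function $g_\rho$ such that $\lim_{k\to\infty}\rho(-(X-k)^+)=0$ for all nonnegative $X\in\mathcal X$ and $\lim_{t\downarrow0}g_\rho(t)=0$; there is a finite set $D(F_0)\subset\mathbb R$ such that $F_0$ is continuously differentiable with strictly positive derivative on $(F_0^{\rightarrow}(0),F_0^{\leftarrow}(1))\setminus D(F_0)$; and $\int_{F_0^{\rightarrow}(0)}^{F_0^{\leftarrow}(1)}\frac{g_\rho(\gamma F_0(x))}{F_0(x)\phi(x)}\,dx<\infty$ for some $\gamma\in(0,1)$. (B) $\rho=\rho_g:\mathcal X\to\mathbb R$ is the distortion risk measure associated with a continuous concave distortion function $g$; the set of points $x\in(F_0^{\rightarrow}(0),F_0^{\leftarrow}(1))$ for which $g$ is not differentiable at $F_0(x)$ has Lebesgue measure zero; and $\int_{F_0^{\rightarrow}(0)}^{F_0^{\leftarrow}(1)}\frac{g(\gamma F_0(x))}{F_0(x)\phi(x)}\,dx<\infty$ for some $\gamma\in(0,1)$. Let $(\Omega',\mathcal F',\mathbb P')$ be a probability space, let $\widehat F_n:\Omega'\to D$ be a map for every $n\in\mathbb N$, and assume: (a) $\widehat F_n$ takes values only in $\mathbb F_{\mathcal X}$ and is $(\mathcal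 F',\mathcal D)$-measurable, $n\in\mathbb N$. (b) $\widehat F_n-F_0$ takes values only in $D_{\phi,F_0}$, $n\in\mathbb N$. (c) There is a nondecreasing sequence $(r_n)\subset(0,\infty)$ such that $r_n\|\widehat F_n-F_0\|_\phi\to0$ $\mathbb P'$-almost surely. Then $$r_n\big(\mathcal R_\rho(\widehat F_n)-\mathcal R_\rho(F_0)\big)\ \longrightarrow\ 0\qquad\mathbb P'\text{-almost surely}.$$
   Context: $(\Omega,\mathcal F,\mathbb P)$ is an atomless probability space and $\mathcal X$ is a linear subspace of $L^1(\Omega,\mathcal F,\mathbb P)$ containing $L^\infty(\Omega,\mathcal F,\mathbb P)$. $F_X$ denotes the distribution function of $X$, and $\mathbb F_{\mathcal X}$ the set of distribution functions of elements of $\mathcal X$. For a distribution function $F$, $F^{\leftarrow}(s):=\inf\{x\in\mathbb R:F(x)\ge s\}$ and $F^{\rightarrow}(s):=\inf\{x\in\mathbb R:F(x)>s\}$ (values $\pm\infty$ possible). A map $\rho:\mathcal X\to\mathbb R$ is a coherent risk measure if it is monotone ($\rho(X)\ge\rho(Y)$ whenever $X\le Y$), cash-invariant ($\rho(X+m)=\rho(X)-m$ for $m\in\mathbb R$), subadditive and positively homogeneous ($\rho(\lambda X)=\lambda\rho(X)$, $\lambda\ge0$). It is law-invariant if $\rho(X)=\rho(Y)$ whenever $X,Y$ have the same law; then $\mathcal R_\rho:\mathbb F_{\mathcal X}\to\mathbb R$ is defined by $\mathcal R_\rho(F_X):=\rho(X)$. A distortion function is a nondecreasing $g:[0,1]\to[0,1]$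 with $g(0)=0$, $g(1)=1$. For a concave distortion function $g$, the distortion risk measure is $\rho_g(X)=\int_{-\infty}^0 g(F_X(x))\,dx-\int_0^\infty(1-g(F_X(x)))\,dx$ for $X$ with $\int_0^\infty g(1-F_{|X|}(x))\,dx<\infty$ (writing $\rho_g:\mathcal X\to\mathbb R$ includes the requirement that all elements of $\mathcal X$ satisfy this). The map $\rho_g$ is a law-invariant coherent risk measure. The distortion function associated with $\rho$ is $g_\rho(t):=\rho(-B_{1,t})$, with $B_{1,t}$ Bernoulli with expectation $t\in[0,1]$. A weight function is a continuous function $\phi:\mathbb R\to[1,\infty)$ that is nonincreasing on $(-\infty,0]$ and nondecreasing on $[0,\infty)$. $D_\phi$ is the space of all càdlàg functions $v$ on $\mathbb R$ with $\|v\|_\phi:=\sup_{x}|v(x)\phi(x)|<\infty$, and $D_{\phi,F_0}$ is the subspace of all $v\in D_\phi$ vanishing outside $[F_0^{\rightarrow}(0),F_0^{\leftarrow}(1)]$. $D$ is the space of all bounded càdlàg functions on $\mathbb R$ and $\mathcal D$ the $\sigma$-algebra on $D$ generated by the coordinate projections. *)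

theory Defs
  imports "HOL-Probability.Probability"
begin

section \<open>Spaces of random variables\<close>

definition atomless :: "'a measure \<Rightarrow> bool" where
  "atomless M \<longleftrightarrow> (\<forall>A\<in>sets M. emeasure M A > 0 \<longrightarrow>
     (\<exists>B\<in>sets M. B \<subseteq> A \<and> 0 < emeasure M B \<and> emeasure M B < emeasure M A))"

text \<open>
  Elements of $L^1$ are represented by integrable functions rather than by classes modulo
  almost sure equality. A linear subspace containing all essentially bounded random variables is
  automatically closed under almost sure equality, so the two views agree.
\<close>

definition ess_bounded :: "'a measure \<Rightarrow> ('a \<Rightarrow> real) set" where
  "ess_bounded M = {X \<in> borel_measurable M. \<exists>C. AE \<omega> in M. \<bar>X \<omega>\<bar> \<le> C}"

definition rv_space :: "'a measure \<Rightarrow> ('a \<Rightarrow> real) set \<Rightarrow> bool" where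
  "rv_space M \<X> \<longleftrightarrow>
     (\<forall>X\<in>\<X>. integrable M X) \<and> ess_bounded M \<subseteq> \<X> \<and>
     (\<forall>X\<in>\<X>. \<forall>Y\<in>\<X>. (\<lambda>\<omega>. X \<omega> + Y \<omega>) \<in> \<X>) \<and>
     (\<forall>X\<in>\<X>. \<forall>c. (\<lambda>\<omega>. c * X \<omega>) \<in> \<X>)"

definition stonean :: "('a \<Rightarrow> real) set \<Rightarrow> bool" where
  "stonean \<X> \<longleftrightarrow> (\<forall>X\<in>\<X>. \<forall>Y\<in>\<X>.
     (\<lambda>\<omega>. min (X \<omega>) (Y \<omega>)) \<in> \<X> \<and> (\<lambda>\<omega>. max (X \<omega>) (Y \<omega>)) \<in> \<X>)"

section \<open>Distribution functions\<close>

definition rv_cdf :: "'a measure \<Rightarrow> ('a \<Rightarrow> real) \<Rightarrow> real \<Rightarrow> real" where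
  "rv_cdf M X = cdf (distr M borel X)"

definition dist_funs :: "'a measure \<Rightarrow> ('a \<Rightarrow> real) set \<Rightarrow> (real \<Rightarrow> real) set" where
  "dist_funs M \<X> = rv_cdf M ` \<X>"

definition left_inv :: "(real \<Rightarrow> real) \<Rightarrow> real \<Rightarrow> ereal" where
  "left_inv F s = Inf {ereal x | x. F x \<ge> s}"

definition right_inv :: "(real \<Rightarrow> real) \<Rightarrow> real \<Rightarrow> ereal" where
  "right_inv F s = Inf {ereal x | x. F x > s}"

definition supp_interior :: "(real \<Rightarrow> real) \<Rightarrow> real set" where
  "supp_interior F = {x. right_inv F 0 < ereal x \<and> ereal x < left_inv F 1}"

section \<open>Risk measures\<close>

definition coherent :: "'a measure \<Rightarrow> ('a \<Rightarrow> real) set \<Rightarrow> (('a \<Rightarrow> real) \<Rightarrow> real) \<Rightarrow> bool" where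
  "coherent M \<X> \<rho> \<longleftrightarrow>
     (\<forall>X\<in>\<X>. \<forall>Y\<in>\<X>. (AE \<omega> in M. X \<omega> \<le> Y \<omega>) \<longrightarrow> \<rho> X \<ge> \<rho> Y) \<and>
     (\<forall>X\<in>\<X>. \<forall>m. \<rho> (\<lambda>\<omega>. X \<omega> + m) = \<rho> X - m) \<and>
     (\<forall>X\<in>\<X>. \<forall>Y\<in>\<X>. \<rho> (\<lambda>\<omega>. X \<omega> + Y \<omega>) \<le> \<rho> X + \<rho> Y) \<and>
     (\<forall>X\<in>\<X>. \<forall>c\<ge>0. \<rho> (\<lambda>\<omega>. c * X \<omega>) = c * \<rho> X)"

definition law_invariant :: "'a measure \<Rightarrow> ('a \<Rightarrow> real) set \<Rightarrow> (('a \<Rightarrow> real) \<Rightarrow> real) \<Rightarrow> bool" where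
  "law_invariant M \<X> \<rho> \<longleftrightarrow>
     (\<forall>X\<in>\<X>. \<forall>Y\<in>\<X>. distr M borel X = distr M borel Y \<longrightarrow> \<rho> X = \<rho> Y)"

text \<open>The next two descriptions are unambiguous when \<open>\<rho>\<close> is law-invariant.\<close>

definition risk_functional ::
  "'a measure \<Rightarrow> ('a \<Rightarrow> real) set \<Rightarrow> (('a \<Rightarrow> real) \<Rightarrow> real) \<Rightarrow> (real \<Rightarrow> real) \<Rightarrow> real" where
  "risk_functional M \<X> \<rho> F = (THE r. \<exists>X\<in>\<X>. rv_cdf M X = F \<and> r = \<rho> X)"

definition is_bernoulli :: "'a measure \<Rightarrow> real \<Rightarrow> ('a \<Rightarrow> real) \<Rightarrow> bool" where
  "is_bernoulli M t B \<longleftrightarrow> B \<in> borel_measurable M \<and>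
     distr M borel B = distr (measure_pmf (bernoulli_pmf t)) borel of_bool"

definition assoc_distortion :: "'a measure \<Rightarrow> (('a \<Rightarrow> real) \<Rightarrow> real) \<Rightarrow> real \<Rightarrow> real" where
  "assoc_distortion M \<rho> t = (THE r. \<exists>B. is_bernoulli M t B \<and> r = \<rho> (\<lambda>\<omega>. - B \<omega>))"

lemma risk_functional_rv_cdf:
  assumes "prob_space M" "rv_space M \<X>" "law_invariant M \<X> \<rho>" "X \<in> \<X>"
  shows "risk_functional M \<X> \<rho> (rv_cdf M X) = \<rho> X"
proof -
  interpret prob_space M by fact
  have "\<rho> Y = \<rho> X" if "Y \<in> \<X>" and eq: "rv_cdf M Y = rv_cdf M X" for Y
  proof -
    have "X \<in> borel_measurable M" "Y \<in> borel_measurable M"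
      using assms(2,4) \<open>Y \<in> \<X>\<close> unfolding rv_space_def by blast+
    then have "real_distribution (distr M borel Y)" "real_distribution (distr M borel X)"
      by simp_all
    then have "distr M borel Y = distr M borel X"
      using eq unfolding rv_cdf_def by (rule cdf_unique)
    then show ?thesis
      using assms(3,4) \<open>Y \<in> \<X>\<close> unfolding law_invariant_def by blast
  qed
  then show ?thesis
    unfolding risk_functional_def using assms(4) by (intro the_equality) blast+
qed

lemma assoc_distortion_bernoulli:
  assumes "rv_space M \<X>" "law_invariant M \<X> \<rho>" "is_bernoulli M t B"
  shows "assoc_distortion M \<rho> t = \<rho> (\<lambda>\<omega>. - B \<omega>)"
proof -
  have mem: "(\<lambda>\<omega>. - C \<omega>) \<in> \<X>" if "is_bernoulli M t C" for C
  proof -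
    have [measurable]: "C \<in> borel_measurable M"
      and law: "distr M borel C = distr (measure_pmf (bernoulli_pmf t)) borel of_bool"
      using that by (auto simp: is_bernoulli_def)
    have "AE x in distr (measure_pmf (bernoulli_pmf t)) borel of_bool. \<bar>x\<bar> \<le> (1::real)"
      by (subst AE_distr_iff) auto
    then have "AE x in distr M borel C. \<bar>x\<bar> \<le> 1"
      unfolding law .
    then have "AE \<omega> in M. \<bar>C \<omega>\<bar> \<le> 1"
      by (subst (asm) AE_distr_iff) auto
    then have "(\<lambda>\<omega>. - C \<omega>) \<in> ess_bounded M"
      by (auto simp: ess_bounded_def)
    then show ?thesis
      using assms(1) unfolding rv_space_def by blast
  qed
  have neg: "distr M borel (\<lambda>\<omega>. - C \<omega>) = distr (distr M borel C) borel uminus"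
    if "is_bernoulli M t C" for C
    using that by (subst distr_distr) (auto simp: is_bernoulli_def comp_def)
  have "\<rho> (\<lambda>\<omega>. - C \<omega>) = \<rho> (\<lambda>\<omega>. - B \<omega>)" if C: "is_bernoulli M t C" for C
  proof -
    have "distr M borel (\<lambda>\<omega>. - C \<omega>) = distr M borel (\<lambda>\<omega>. - B \<omega>)"
      using C assms(3) unfolding neg[OF C] neg[OF assms(3)] by (simp add: is_bernoulli_def)
    then show ?thesis
      using mem[OF C] mem[OF assms(3)] assms(2) unfolding law_invariant_def by blast
  qed
  then show ?thesis
    unfolding assoc_distortion_def using assms(3) by (intro the_equality) blast+
qed

section \<open>Distortion risk measures\<close>

text \<open>Functions on $[0,1]$ are represented by functions on the reals whose values outside
  $[0,1]$ are irrelevant.\<close>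

definition distortion_function :: "(real \<Rightarrow> real) \<Rightarrow> bool" where
  "distortion_function g \<longleftrightarrow>
     g \<in> {0..1} \<rightarrow> {0..1} \<and> mono_on {0..1} g \<and> g 0 = 0 \<and> g 1 = 1"

definition distortion_domain :: "'a measure \<Rightarrow> (real \<Rightarrow> real) \<Rightarrow> ('a \<Rightarrow> real) set" where
  "distortion_domain M g = {X \<in> borel_measurable M.
     (\<integral>\<^sup>+x\<in>{0..}. ennreal (g (1 - rv_cdf M (\<lambda>\<omega>. \<bar>X \<omega>\<bar>) x)) \<partial>lborel) < \<infinity>}"

definition distortion_risk :: "'a measure \<Rightarrow> (real \<Rightarrow> real) \<Rightarrow> ('a \<Rightarrow> real) \<Rightarrow> real" where
  "distortion_risk M g X =
     (LINT x:{..0}|lborel. g (rv_cdf M X x)) - (LINT x:{0..}|lborel. 1 - g (rv_cdf M X x))"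

section \<open>Weighted cadlag functions\<close>

definition weight_function :: "(real \<Rightarrow> real) \<Rightarrow> bool" where
  "weight_function \<phi> \<longleftrightarrow> continuous_on UNIV \<phi> \<and> (\<forall>x. 1 \<le> \<phi> x) \<and>
     antimono_on {..0} \<phi> \<and> mono_on {0..} \<phi>"

definition cadlag :: "(real \<Rightarrow> real) \<Rightarrow> bool" where
  "cadlag v \<longleftrightarrow> (\<forall>x. continuous (at_right x) v \<and> (\<exists>l. (v \<longlongrightarrow> l) (at_left x)))"

text \<open>The supremum is a real one and is only meaningful when it is finite, as it is on
  \<open>weighted_cadlag \<phi>\<close>.\<close>

definition weighted_norm :: "(real \<Rightarrow> real) \<Rightarrow> (real \<Rightarrow> real) \<Rightarrow> real" where
  "weighted_norm \<phi> v = (SUP x. \<bar>v x * \<phi> x\<bar>)"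

definition weighted_cadlag :: "(real \<Rightarrow> real) \<Rightarrow> (real \<Rightarrow> real) set" where
  "weighted_cadlag \<phi> = {v. cadlag v \<and> bdd_above (range (\<lambda>x. \<bar>v x * \<phi> x\<bar>))}"

definition weighted_cadlag_supp :: "(real \<Rightarrow> real) \<Rightarrow> (real \<Rightarrow> real) \<Rightarrow> (real \<Rightarrow> real) set" where
  "weighted_cadlag_supp \<phi> F = {v \<in> weighted_cadlag \<phi>.
     \<forall>x. ereal x \<notin> {right_inv F 0..left_inv F 1} \<longrightarrow> v x = 0}"

definition cadlag_bdd :: "(real \<Rightarrow> real) set" where
  "cadlag_bdd = {v. cadlag v \<and> bounded (range v)}"

definition cadlag_measure :: "(real \<Rightarrow> real) measure" where
  "cadlag_measure = sigma cadlag_bdd {{v \<in> cadlag_bdd. v x \<in> B} | x B. B \<in> sets borel}"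

end

theory Submission
  imports Defs
begin

text \<open>
  The functional is locally Lipschitz at \<open>F0\<close> for the weighted norm, so the rate carries over.
  For a concave distortion \<open>g\<close>, the slope bound \<open>g b - g a \<le> (b - a) * g c / c\<close> for
  \<open>c \<le> a \<le> b\<close> gives
  \<open>\<bar>g s - g t\<bar> \<le> \<bar>s - t\<bar> * g (\<gamma> * s) / (\<gamma> * (1 - \<gamma>) * s)\<close>, which is integrated over the support.
  For a general law-invariant coherent \<open>\<rho>\<close> no Kusuoka representation is needed: after truncation and
  discretisation \<open>\<rho>\<close> acts on step functions over \<open>N\<close> equiprobable cells, where it is
  sublinear and permutation-invariant. A supporting linear functional there can be chosen with
  decreasing weights; its partial sums form a concave distortion dominated by the distortion of
  \<open>\<rho>\<close>, and the same slope bound applies.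
\<close>

section \<open>Sublinear functionals\<close>

text \<open>Integrability is assumed at \<open>F0\<close> alone, so only \<open>F0\<close> may occur
  in the denominator of the bound. Hence the slope estimate is asymmetric in its two levels
  \<open>s\<close> and \<open>t\<close>, and the same denominator \<open>s\<close> serves both signs
  of the difference. If \<open>t \<ge> \<gamma> * s\<close>, slopes are at most
  \<open>g c / c\<close> with \<open>c = \<gamma> * s\<close>; if \<open>t < \<gamma> * s\<close>,
  the gap is at least \<open>(1 - \<gamma>) * s\<close>, so even the full value \<open>g s\<close>
  is affordable. Together this gives the factor \<open>1 / (\<gamma> * (1 - \<gamma>))\<close>. For
  general \<rho> the two risks need not come from one common distortion. A functional that supports
  at one discretised variable is exact there and merely dominated at the other, which is the right
  direction for a one-sided inequality. Both variables live on the same cells because \<rho> sees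
  only laws and the level sets are nested. Levels that are not multiples of \<open>1 / N\<close>
  cost at most \<open>g (1 / N)\<close> each, which is where \<open>g\<close> tending to 0 at 0
  enters. Sums over a grid are compared with the Lebesgue integral of a merely measurable function
  by averaging over the offset of the grid.\<close>

definition sublinear :: "(('i \<Rightarrow> real) \<Rightarrow> real) \<Rightarrow> bool" where
  "sublinear p \<longleftrightarrow> (\<forall>x y. p (\<lambda>i. x i + y i) \<le> p x + p y) \<and>
     (\<forall>x. \<forall>c\<ge>0. p (\<lambda>i. c * x i) = c * p x)"

lemma sublinear_add: "sublinear p \<Longrightarrow> p (\<lambda>i. x i + y i) \<le> p x + p y"
  and sublinear_scale: "sublinear p \<Longrightarrow> c \<ge> 0 \<Longrightarrow> p (\<lambda>i. c * x i) = c * p x"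
  by (auto simp: sublinear_def)

lemma sublinear_zero: "sublinear p \<Longrightarrow> p (\<lambda>i. 0) = 0"
  using sublinear_scale[of p 0 "\<lambda>i. 0"] by simp

lemma sublinear_uminus: "sublinear p \<Longrightarrow> - p (\<lambda>i. - x i) \<le> p x"
  using sublinear_add[of p x "\<lambda>i. - x i"] sublinear_zero[of p] by simp

text \<open>An inequality for positive factors is enough: applied with \<open>inverse c\<close> to
  the scaled argument it yields the reverse inequality, and the factor 0 is covered by the value at
  the zero vector.\<close>

lemma sublinearI:
  assumes add: "\<And>x y. p (\<lambda>i. x i + y i) \<le> p x + p y"
    and scale: "\<And>x c. c > 0 \<Longrightarrow> p (\<lambda>i. c * x i) \<le> c * p x"
    and zero: "p (\<lambda>i. 0) = 0"
  shows "sublinear p"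
proof -
  have "p (\<lambda>i. c * x i) = c * p x" if "c \<ge> 0" for x c
  proof (cases "c = 0")
    case False
    with that have c: "c > 0" by simp
    have "p (\<lambda>i. inverse c * (c * x i)) \<le> inverse c * p (\<lambda>i. c * x i)"
      using c by (intro scale) auto
    also have "(\<lambda>i. inverse c * (c * x i)) = x"
      using c by (auto simp: field_simps)
    finally have "c * p x \<le> p (\<lambda>i. c * x i)"
      using c by (simp add: field_simps)
    with scale[OF c, of x] show ?thesis by simp
  qed (simp add: zero)
  with add show ?thesis by (auto simp: sublinear_def)
qed

text \<open>The Hahn-Banach step. The functional \<open>p'\<close> is the one-sided directional
  derivative of \<open>p\<close> at \<open>x\<close>: with \<open>t = 1 / s\<close> the expression
  under the infimum becomes the difference quotient \<open>(p (x + s z) - p x) / s\<close>, which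
  decreases with \<open>s\<close>. It lies below \<open>p\<close> and has no kink along the line
  through \<open>x\<close>.\<close>

lemma sublinear_linearize:
  assumes p: "sublinear p"
  shows "\<exists>p'. sublinear p' \<and> (\<forall>z. p' z \<le> p z) \<and> p' x = p x \<and> p' (\<lambda>i. - x i) = - p x"
proof -
  define S where "S z = (\<lambda>t. p (\<lambda>i. z i + t * x i) - t * p x) ` {0..}" for z
  define p' where "p' z = Inf (S z)" for z
  \<comment> \<open>Subadditivity gives a lower bound independent of \<open>t\<close>, so the
    infimum over \<open>S z\<close> is finite.\<close>
  have ge: "- p (\<lambda>i. - z i) \<le> p (\<lambda>i. z i + t * x i) - t * p x" if "t \<ge> 0" for t z
    using sublinear_add[OF p, of "\<lambda>i. z i + t * x i" "\<lambda>i. - z i"]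
      sublinear_scale[OF p that, of x] by simp
  then have bdd: "bdd_below (S z)" for z
    unfolding S_def by (intro bdd_belowI[of _ "- p (\<lambda>i. - z i)"]) auto
  have ne: "S z \<noteq> {}" for z by (auto simp: S_def)
  have le: "p' z \<le> p (\<lambda>i. z i + t * x i) - t * p x" if "t \<ge> 0" for t z
    unfolding p'_def by (intro cInf_lower bdd) (auto simp: S_def that)
  have approx: "\<exists>t\<ge>0. p (\<lambda>i. z i + t * x i) - t * p x < p' z + e" if "e > 0" for z e
    using cInf_lessD[OF ne, of z "p' z + e"] that by (auto simp: S_def p'_def)
  have zero: "p' (\<lambda>i. 0) = 0"
  proof (rule antisym)
    show "p' (\<lambda>i. 0) \<le> 0" using le[of 0 "\<lambda>i. 0"] sublinear_zero[OF p] by simp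
    show "0 \<le> p' (\<lambda>i. 0)"
      unfolding p'_def using ge[of _ "\<lambda>i. 0"] sublinear_zero[OF p]
      by (intro cInf_greatest ne) (auto simp: S_def)
  qed
  have sub: "sublinear p'"
  proof (rule sublinearI)
    fix z w
    show "p' (\<lambda>i. z i + w i) \<le> p' z + p' w"
    proof (rule field_le_epsilon)
      fix e :: real assume "e > 0"
      then obtain t s where ts: "t \<ge> 0" "p (\<lambda>i. z i + t * x i) - t * p x < p' z + e / 2"
        "s \<ge> 0" "p (\<lambda>i. w i + s * x i) - s * p x < p' w + e / 2"
        using approx[of "e / 2" z] approx[of "e / 2" w] by auto
      have "p' (\<lambda>i. z i + w i) \<le> p (\<lambda>i. z i + w i + (t + s) * x i) - (t + s) * p x"
        using ts by (intro le) auto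
      also have "p (\<lambda>i. z i + w i + (t + s) * x i) \<le>
          p (\<lambda>i. z i + t * x i) + p (\<lambda>i. w i + s * x i)"
        using sublinear_add[OF p, of "\<lambda>i. z i + t * x i" "\<lambda>i. w i + s * x i"]
        by (simp add: algebra_simps)
      finally show "p' (\<lambda>i. z i + w i) \<le> p' z + p' w + e"
        using ts by (simp add: algebra_simps)
    qed
  next
    fix z and c :: real assume c: "c > 0"
    show "p' (\<lambda>i. c * z i) \<le> c * p' z"
    proof (rule field_le_epsilon)
      fix e :: real assume "e > 0"
      then obtain t where t: "t \<ge> 0" "p (\<lambda>i. z i + t * x i) - t * p x < p' z + e / c"
        using approx[of "e / c" z] c by auto
      have "p' (\<lambda>i. c * z i) \<le> p (\<lambda>i. c * z i + (c * t) * x i) - (c * t) * p x"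
        using t c by (intro le) auto
      also have "p (\<lambda>i. c * z i + (c * t) * x i) = c * p (\<lambda>i. z i + t * x i)"
        using sublinear_scale[OF p, of c "\<lambda>i. z i + t * x i"] c by (simp add: algebra_simps)
      also have "c * p (\<lambda>i. z i + t * x i) - c * t * p x
          = c * (p (\<lambda>i. z i + t * x i) - t * p x)"
        by (simp add: algebra_simps)
      also have "\<dots> \<le> c * (p' z + e / c)"
        using t c by (intro mult_left_mono) auto
      also have "\<dots> = c * p' z + e" using c by (simp add: field_simps)
      finally show "p' (\<lambda>i. c * z i) \<le> c * p' z + e" .
    qed
  qed (rule zero)
  have dom: "p' z \<le> p z" for z using le[of 0 z] by simp
  \<comment> \<open>The value \<open>t = 1\<close> cancels the argument:
    \<open>- x + 1 * x = 0\<close>.\<close>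
  have neg: "p' (\<lambda>i. - x i) \<le> - p x"
    using le[of 1 "\<lambda>i. - x i"] sublinear_zero[OF p] by simp
  have "p' x = p x" "p' (\<lambda>i. - x i) = - p x"
    using neg dom[of x] sublinear_uminus[OF sub, of x] by linarith+
  with sub dom show ?thesis by blast
qed

text \<open>Linearising along \<open>x\<close> and then along each of the first \<open>N\<close>
  unit vectors leaves a functional below \<open>p\<close> that is linear on their span. By
  \<open>cong\<close> only these coordinates count, so finitely many linearisations suffice.\<close>

lemma sublinear_supporting:
  fixes p :: "(nat \<Rightarrow> real) \<Rightarrow> real"
  assumes p: "sublinear p" and cong: "\<And>z w. (\<And>i. i < N \<Longrightarrow> z i = w i) \<Longrightarrow> p z = p w"
  shows "\<exists>q. (\<forall>z. (\<Sum>i<N. q i * z i) \<le> p z) \<and> (\<Sum>i<N. q i * x i) = p x"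
proof -
  define e :: "nat \<Rightarrow> nat \<Rightarrow> real" where "e i = (\<lambda>j. of_bool (j = i))" for i
  have "\<exists>p'. sublinear p' \<and> (\<forall>z. p' z \<le> p z) \<and> p' (\<lambda>i. - x i) = - p x \<and>
      (\<forall>i<n. p' (\<lambda>j. - e i j) = - p' (e i))" for n
  proof (induction n)
    case 0
    show ?case using sublinear_linearize[OF p, of x] by auto
  next
    case (Suc n)
    then obtain p1 where p1: "sublinear p1" "\<And>z. p1 z \<le> p z" "p1 (\<lambda>i. - x i) = - p x"
      "\<And>i. i < n \<Longrightarrow> p1 (\<lambda>j. - e i j) = - p1 (e i)" by blast
    obtain p2 where p2: "sublinear p2" "\<And>z. p2 z \<le> p1 z" "p2 (e n) = p1 (e n)"
      "p2 (\<lambda>j. - e n j) = - p1 (e n)"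
      using sublinear_linearize[OF p1(1), of "e n"] by blast
    \<comment> \<open>Later steps do not spoil earlier ones: where \<open>p1\<close> is already
      linear, \<open>p2 y \<le> p1 y = - p1 (- y) \<le> - p2 (- y) \<le> p2 y\<close> forces
      equality.\<close>
    have keep: "p2 (\<lambda>j. - y j) = - p2 y \<and> p2 y = p1 y" if "p1 (\<lambda>j. - y j) = - p1 y" for y
      using that p2(2)[of y] p2(2)[of "\<lambda>j. - y j"] sublinear_uminus[OF p2(1), of y]
      by linarith
    have "p1 x = p x"
      using sublinear_uminus[OF p1(1), of x] p1(2)[of x] p1(3) by linarith
    then have "p2 (\<lambda>i. - x i) = - p x"
      using keep[of x] p1(3) by auto
    moreover have "p2 (\<lambda>j. - e i j) = - p2 (e i)" if "i < Suc n" for i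
      using that keep[of "e i"] p1(4)[of i] p2(3,4) by (cases "i = n") auto
    ultimately show ?case
      using p2(1,2) p1(2) by (intro exI[of _ p2]) (auto intro: order_trans)
  qed
  from this[of N] obtain p' where p': "sublinear p'" "\<And>z. p' z \<le> p z"
    "p' (\<lambda>i. - x i) = - p x" "\<And>i. i < N \<Longrightarrow> p' (\<lambda>j. - e i j) = - p' (e i)" by blast
  define q where "q i = p' (e i)" for i
  have single: "p' (\<lambda>j. c * e i j) = c * q i" if "i < N" for c i
  proof (cases "c \<ge> 0")
    case True
    then show ?thesis using sublinear_scale[OF p'(1), of c "e i"] by (simp add: q_def)
  next
    case False
    then show ?thesis
      using sublinear_scale[OF p'(1), of "- c" "\<lambda>j. - e i j"] p'(4)[OF that] by (simp add: q_def)
  qed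
  have up: "p' (\<lambda>j. \<Sum>i<n. z i * e i j) \<le> (\<Sum>i<n. q i * z i)" if "n \<le> N" for z n
    using that
  proof (induction n)
    case 0
    then show ?case using sublinear_zero[OF p'(1)] by simp
  next
    case (Suc n)
    then show ?case
      using sublinear_add[OF p'(1), of "\<lambda>j. \<Sum>i<n. z i * e i j" "\<lambda>j. z n * e n j"]
        single[of n "z n"] by (simp add: mult.commute)
  qed
  have exp: "(\<Sum>i<N. z i * e i j) = (if j < N then z j else 0)" for z j
    by (auto simp: e_def of_bool_def if_distrib[of "\<lambda>t. _ * t"] sum.delta cong: if_cong)
  have le: "(\<Sum>i<N. q i * z i) \<le> p z" for z
  proof -
    have "p' (\<lambda>j. \<Sum>i<N. - z i * e i j) \<le> (\<Sum>i<N. q i * - z i)"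
      using up[of N "\<lambda>i. - z i"] by simp
    then have "(\<Sum>i<N. q i * z i) \<le> - p' (\<lambda>j. - (\<Sum>i<N. z i * e i j))"
      by (simp add: sum_negf)
    also have "\<dots> \<le> p' (\<lambda>j. \<Sum>i<N. z i * e i j)"
      by (rule sublinear_uminus[OF p'(1)])
    also have "\<dots> \<le> p (\<lambda>j. \<Sum>i<N. z i * e i j)" by (rule p'(2))
    also have "\<dots> = p z" by (rule cong) (simp add: exp)
    finally show ?thesis .
  qed
  have "p x \<le> (\<Sum>i<N. q i * x i)"
  proof -
    have "p' x = p x"
      using sublinear_uminus[OF p'(1), of x] p'(2)[of x] p'(3) by linarith
    \<comment> \<open>The remainder of \<open>x\<close> vanishes on the first \<open>N\<close>
      coordinates. The property \<open>cong\<close> is known for \<open>p\<close> and not for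
      \<open>p'\<close>, so the remainder is estimated through \<open>p\<close>.\<close>
    have "p' x \<le> p' (\<lambda>j. \<Sum>i<N. x i * e i j) + p' (\<lambda>j. x j - (\<Sum>i<N. x i * e i j))"
      using sublinear_add[OF p'(1), of "\<lambda>j. \<Sum>i<N. x i * e i j"
        "\<lambda>j. x j - (\<Sum>i<N. x i * e i j)"] by simp
    also have "p' (\<lambda>j. x j - (\<Sum>i<N. x i * e i j)) \<le> p (\<lambda>j. x j - (\<Sum>i<N. x i * e i j))"
      by (rule p'(2))
    also have "\<dots> = p (\<lambda>j. 0)" by (rule cong) (simp add: exp)
    also have "\<dots> = 0" by (rule sublinear_zero[OF p])
    finally show ?thesis using up[of N x] \<open>p' x = p x\<close> by simp
  qed
  then show ?thesis using le by (intro exI[of _ q]) (auto intro: antisym)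
qed

section \<open>Rearrangement of coefficients and partial sums of decreasing weights\<close>

lemma ex_permutes_antimono:
  fixes q :: "nat \<Rightarrow> real"
  shows "\<exists>\<pi>. \<pi> permutes {..<N} \<and> antimono_on {..<N} (q \<circ> \<pi>)"
proof -
  define xs where "xs = map q [0..<N]"
  have "mset (rev (sort xs)) = mset xs" by simp
  then obtain \<pi> where \<pi>: "\<pi> permutes {..<length xs}" "permute_list \<pi> xs = rev (sort xs)"
    by (rule mset_eq_permutation)
  have len: "length xs = N" by (simp add: xs_def)
  have nth: "rev (sort xs) ! i = q (\<pi> i)" if "i < N" for i
  proof -
    have "\<pi> i < N" using permutes_in_image[OF \<pi>(1), of i] that len by simp
    then show ?thesis
      using permute_list_nth[OF \<pi>(1), of i] \<pi>(2) that len by (simp add: xs_def)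
  qed
  have "sorted (sort xs)" by simp
  then have "rev (sort xs) ! i \<ge> rev (sort xs) ! j" if "i \<le> j" "j < N" for i j
    using that len by (simp add: rev_nth sorted_nth_mono)
  then have "antimono_on {..<N} (q \<circ> \<pi>)"
    by (auto simp: monotone_on_def nth)
  with \<pi>(1) len show ?thesis by auto
qed

text \<open>Both sums have \<open>card S\<close> terms, so the threshold
  \<open>c = q (a - 1)\<close> may be subtracted from every term. Then terms with index below
  \<open>a\<close> are nonnegative and all others are nonpositive.\<close>

lemma sum_le_sum_lessThan:
  fixes q :: "nat \<Rightarrow> real"
  assumes q: "antimono_on {..<N} q" and S: "S \<subseteq> {..<N}"
  shows "sum q S \<le> (\<Sum>i<card S. q i)"
proof -
  define a where "a = card S"
  have fin: "finite S" using S finite_subset by blast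
  have aN: "a \<le> N" using card_mono[OF _ S] by (simp add: a_def)
  show ?thesis
  proof (cases "a = 0")
    case True
    then show ?thesis using fin by (simp add: a_def)
  next
    case False
    define c where "c = q (a - 1)"
    have hi: "q i \<ge> c" if "i < a" for i
      using that aN unfolding c_def by (intro monotone_onD[OF q]) auto
    have lo: "q i \<le> c" if "i \<ge> a" "i < N" for i
      using that False unfolding c_def by (intro monotone_onD[OF q]) auto
    have "(\<Sum>i\<in>S. q i - c) \<le> (\<Sum>i\<in>S. if i < a then q i - c else 0)"
      using lo S by (intro sum_mono) (auto simp: subset_iff)
    also have "\<dots> = (\<Sum>i\<in>S \<inter> {..<a}. q i - c)"
      using fin by (subst sum.inter_restrict) auto
    also have "\<dots> \<le> (\<Sum>i<a. q i - c)"
      using hi by (intro sum_mono2) auto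
    finally show ?thesis by (simp add: sum_subtractf a_def)
  qed
qed

text \<open>A discrete layer-cake formula: a vector built from initial segments pairs with
  \<open>f\<close> through partial sums of \<open>f\<close>. This is how the distortion, whose
  values are such partial sums, enters.\<close>

lemma sum_layers:
  fixes f :: "nat \<Rightarrow> real"
  assumes a: "\<And>j. j < m \<Longrightarrow> a j \<le> N"
  shows "(\<Sum>i<N. f i * (h * (\<Sum>j<m. of_bool (i < a j)))) = h * (\<Sum>j<m. \<Sum>i<a j. f i)"
proof -
  have "(\<Sum>i<N. f i * (h * (\<Sum>j<m. of_bool (i < a j)))) =
      h * (\<Sum>j<m. \<Sum>i<N. f i * of_bool (i < a j))"
    by (subst sum.swap) (simp add: sum_distrib_left algebra_simps)
  also have "(\<Sum>i<N. f i * of_bool (i < a j)) = (\<Sum>i<a j. f i)" if "j < m" for j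
  proof -
    have "(\<Sum>i<N. f i * of_bool (i < a j)) = (\<Sum>i<N. if i \<in> {..<a j} then f i else 0)"
      by (intro sum.cong) auto
    also have "\<dots> = (\<Sum>i\<in>{..<N} \<inter> {..<a j}. f i)"
      by (rule sum.inter_restrict[symmetric]) simp
    also have "{..<N} \<inter> {..<a j} = {..<a j}" using a[OF that] by auto
    finally show ?thesis .
  qed
  then have "(\<Sum>j<m. \<Sum>i<N. f i * of_bool (i < a j)) = (\<Sum>j<m. \<Sum>i<a j. f i)"
    by (rule sum.cong[OF refl]) (simp only: lessThan_iff)
  finally show ?thesis .
qed

text \<open>The supporting functional may be sorted: on a vector built from initial segments,
  sorting the coefficients can only increase its value, and by permutation invariance it remains
  dominated.\<close>

lemma sublinear_supporting_sorted:
  fixes p :: "(nat \<Rightarrow> real) \<Rightarrow> real"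
  assumes p: "sublinear p" and cong: "\<And>z w. (\<And>i. i < N \<Longrightarrow> z i = w i) \<Longrightarrow> p z = p w"
    and perm: "\<And>\<pi> z. \<pi> permutes {..<N} \<Longrightarrow> p (z \<circ> \<pi>) = p z"
    and nonpos: "\<And>i. i < N \<Longrightarrow> p (\<lambda>j. - of_bool (j = i)) \<le> 0"
    and a: "\<And>j. j < m \<Longrightarrow> a j \<le> N" and h: "h \<ge> 0"
  shows "\<exists>q. antimono q \<and> (\<forall>i. q i \<ge> 0) \<and> (\<forall>z. (\<Sum>i<N. q i * z i) \<le> p z) \<and>
    p (\<lambda>i. h * (\<Sum>j<m. of_bool (i < a j))) = h * (\<Sum>j<m. \<Sum>i<a j. q i)"
proof -
  define x where "x i = h * (\<Sum>j<m. of_bool (i < a j))" for i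
  obtain q0 where q0: "\<And>z. (\<Sum>i<N. q0 i * z i) \<le> p z" "(\<Sum>i<N. q0 i * x i) = p x"
    using sublinear_supporting[OF p cong, of N x] by blast
  obtain \<pi> where \<pi>: "\<pi> permutes {..<N}" "antimono_on {..<N} (q0 \<circ> \<pi>)"
    using ex_permutes_antimono by blast
  \<comment> \<open>Since the coefficients turn out to be nonnegative, the value 0 beyond
    \<open>N\<close> keeps \<open>q\<close> decreasing on all natural numbers.\<close>
  define q where "q i = (if i < N then q0 (\<pi> i) else 0)" for i
  have q_on: "antimono_on {..<N} q"
    using \<pi>(2) by (auto simp: monotone_on_def q_def)
  have q0_nonneg: "q0 i \<ge> 0" if "i < N" for i
  proof -
    have "(\<Sum>k<N. q0 k * - of_bool (k = i)) = - q0 i"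
      using that by (simp add: of_bool_def if_distrib[of "\<lambda>t. _ * t"] sum.delta sum_negf cong: if_cong)
    then show ?thesis using q0(1)[of "\<lambda>j. - of_bool (j = i)"] nonpos[OF that] by simp
  qed
  then have q_nonneg: "q i \<ge> 0" for i
    using permutes_in_image[OF \<pi>(1), of i] by (auto simp: q_def)
  have "antimono q"
  proof (rule antimonoI)
    fix i k :: nat assume "i \<le> k"
    show "q k \<le> q i"
    proof (cases "k < N")
      case True
      with \<open>i \<le> k\<close> show ?thesis by (intro monotone_onD[OF q_on]) auto
    next
      case False
      with q_nonneg[of i] show ?thesis by (simp add: q_def)
    qed
  qed
  \<comment> \<open>Sorting the coefficients amounts to permuting the argument, to which
    \<open>p\<close> is blind by \<open>perm\<close>.\<close>
  have dom: "(\<Sum>i<N. q i * z i) \<le> p z" for z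
  proof -
    have "(\<Sum>i<N. q i * z i) = (\<Sum>i<N. q0 (\<pi> i) * (z \<circ> inv \<pi>) (\<pi> i))"
      by (intro sum.cong) (auto simp: q_def permutes_inverses[OF \<pi>(1)])
    also have "\<dots> = (\<Sum>i<N. q0 i * (z \<circ> inv \<pi>) i)"
      using sum.permute[OF \<pi>(1), of "\<lambda>i. q0 i * (z \<circ> inv \<pi>) i"] by (simp add: comp_def)
    also have "\<dots> \<le> p (z \<circ> inv \<pi>)" by (rule q0)
    also have "\<dots> = p z" by (rule perm[OF permutes_inv[OF \<pi>(1)]])
    finally show ?thesis .
  qed
  have layers: "(\<Sum>i<N. f i * x i) = h * (\<Sum>j<m. \<Sum>i<a j. f i)" for f
    unfolding x_def using a by (rule sum_layers)
  \<comment> \<open>In the sorted numbering the first \<open>a j\<close> original coefficients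
    occupy a set \<open>S\<close> of \<open>a j\<close> indices, and no set of that size has a
    larger sum than the initial segment.\<close>
  have "(\<Sum>i<a j. q0 i) \<le> (\<Sum>i<a j. q i)" if "j < m" for j
  proof -
    define S where "S = inv \<pi> ` {..<a j}"
    have inj: "inj (inv \<pi>)" using permutes_inj[OF permutes_inv[OF \<pi>(1)]] .
    have "S \<subseteq> inv \<pi> ` {..<N}" unfolding S_def using a[OF that] by (intro image_mono) auto
    then have S: "S \<subseteq> {..<N}" by (simp only: permutes_image[OF permutes_inv[OF \<pi>(1)]])
    have "card S = a j"
      unfolding S_def using inj by (subst card_image) (auto intro: inj_on_subset)
    have "(\<Sum>i<a j. q0 i) = (\<Sum>i<a j. q (inv \<pi> i))"
    proof (intro sum.cong refl)
      fix i assume "i \<in> {..<a j}"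
      then have "inv \<pi> i \<in> S" by (simp add: S_def)
      with S have "inv \<pi> i < N" by blast
      then show "q0 i = q (inv \<pi> i)"
        by (simp add: q_def permutes_inverses[OF \<pi>(1)])
    qed
    also have "\<dots> = sum q S"
      unfolding S_def using inj by (subst sum.reindex) (auto intro: inj_on_subset)
    also have "\<dots> \<le> (\<Sum>i<a j. q i)"
      using sum_le_sum_lessThan[OF q_on S] \<open>card S = a j\<close> by simp
    finally show ?thesis .
  qed
  then have "p x \<le> (\<Sum>i<N. q i * x i)"
    unfolding q0(2)[symmetric] layers using h by (intro mult_left_mono sum_mono[where K = "{..<m}"]) auto
  then have "p x = h * (\<Sum>j<m. \<Sum>i<a j. q i)"
    using dom[of x] layers[of q] by simp
  then show ?thesis
    using \<open>antimono q\<close> q_nonneg dom unfolding x_def by blast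
qed

text \<open>Partial sums of decreasing nonnegative weights behave like a concave distortion. From
  index \<open>l\<close> on every weight is at most the mean \<open>A\<close> of the first
  \<open>l\<close> ones, which settles \<open>b \<ge> l\<close>. For \<open>b < l\<close> the gap
  \<open>a - b\<close> is at least \<open>(1 - \<gamma>) * a\<close>, while
  \<open>Q a \<le> a * A\<close>; hence the factor \<open>1 / (1 - \<gamma>)\<close>.\<close>

lemma antimono_partial_sums_diff:
  fixes q :: "nat \<Rightarrow> real"
  assumes q: "antimono q" "\<And>i. q i \<ge> 0" and \<gamma>: "0 < \<gamma>" "\<gamma> < 1" and l: "1 \<le> l" "real l \<le> \<gamma> * real a"
  shows "\<bar>(\<Sum>i<a. q i) - (\<Sum>i<b. q i)\<bar> \<le> \<bar>real a - real b\<bar> / (1 - \<gamma>) * ((\<Sum>i<l. q i) / real l)"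
proof -
  define Q where "Q k = (\<Sum>i<k. q i)" for k
  define A where "A = Q l / real l"
  have A: "A \<ge> 0" unfolding A_def Q_def by (intro divide_nonneg_nonneg sum_nonneg q) auto
  have q_le: "q i \<le> A" if "l \<le> i" for i
  proof -
    have "(\<Sum>j<l. q i) \<le> Q l"
      unfolding Q_def using that by (intro sum_mono antimonoD[OF q(1)]) auto
    then show ?thesis using l by (simp add: A_def field_simps)
  qed
  have incr: "Q k \<le> Q k'" if "k \<le> k'" for k k'
    unfolding Q_def using that q by (intro sum_mono2) auto
  have diff: "Q k' - Q k \<le> (real k' - real k) * A" if "l \<le> k" "k \<le> k'" for k k'
  proof -
    have "Q k' - Q k = (\<Sum>i\<in>{k..<k'}. q i)"
      unfolding Q_def using sum_diff_nat_ivl[of 0 k k' q] that by (simp add: atLeast0LessThan)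
    also have "\<dots> \<le> (\<Sum>i\<in>{k..<k'}. A)"
      using that by (intro sum_mono q_le) auto
    finally show ?thesis using that by (simp add: of_nat_diff)
  qed
  have la: "l \<le> a"
  proof -
    have "\<gamma> * real a \<le> 1 * real a" using \<gamma> by (intro mult_right_mono) auto
    with l(2) show ?thesis by linarith
  qed
  have ge: "\<bar>real a - real b\<bar> * A \<le> \<bar>real a - real b\<bar> / (1 - \<gamma>) * A"
  proof (intro mult_right_mono A)
    have "\<bar>real a - real b\<bar> * (1 - \<gamma>) \<le> \<bar>real a - real b\<bar> * 1"
      using \<gamma> by (intro mult_left_mono) auto
    then show "\<bar>real a - real b\<bar> \<le> \<bar>real a - real b\<bar> / (1 - \<gamma>)"
      using \<gamma> by (simp add: field_simps)
  qed
  consider "a \<le> b" | "l \<le> b" "b < a" | "b < l" by linarith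
  then have "\<bar>Q a - Q b\<bar> \<le> \<bar>real a - real b\<bar> / (1 - \<gamma>) * A"
  proof cases
    case 1
    then show ?thesis using diff[OF la 1] incr[OF 1] ge by simp
  next
    case 2
    then show ?thesis using diff[of b a] incr[of b a] ge by simp
  next
    case 3
    have "Q l + (real a - real l) * A = real a * A"
      using l by (simp add: A_def field_simps)
    then have "Q a \<le> real a * A" using diff[OF order_refl la] by simp
    moreover have "0 \<le> Q b" unfolding Q_def by (intro sum_nonneg q)
    moreover have "Q b \<le> Q a" using 3 la by (intro incr) auto
    moreover have "real a * A \<le> \<bar>real a - real b\<bar> / (1 - \<gamma>) * A"
    proof (intro mult_right_mono A)
      have "real b \<le> \<gamma> * real a" using 3 l by linarith
      then have "real a * (1 - \<gamma>) \<le> \<bar>real a - real b\<bar>" by (simp add: algebra_simps)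
      then show "real a \<le> \<bar>real a - real b\<bar> / (1 - \<gamma>)"
        using \<gamma> by (simp add: field_simps)
    qed
    ultimately show ?thesis by linarith
  qed
  then show ?thesis by (simp add: Q_def A_def)
qed

section \<open>Atomless probability spaces\<close>

text \<open>Of a proper part \<open>C\<close> of \<open>B\<close> and its complement in
  \<open>B\<close>, one has at most half the measure of \<open>B\<close>; iterated halving falls
  below any \<open>e\<close>.\<close>

lemma (in finite_measure) atomless_small_subset:
  assumes atomless: "atomless M" and A: "A \<in> sets M" "measure M A > 0" and e: "e > 0"
  shows "\<exists>B\<in>sets M. B \<subseteq> A \<and> 0 < measure M B \<and> measure M B \<le> e"
proof -
  have half: "\<exists>C\<in>sets M. C \<subseteq> B \<and> 0 < measure M C \<and> measure M C \<le> measure M B / 2"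
    if B: "B \<in> sets M" "measure M B > 0" for B
  proof -
    have "emeasure M B > 0" using B by (simp add: emeasure_eq_measure)
    then obtain C where C: "C \<in> sets M" "C \<subseteq> B" "0 < emeasure M C" "emeasure M C < emeasure M B"
      using atomless B unfolding atomless_def by blast
    then have C': "0 < measure M C" "measure M C < measure M B"
      by (auto simp: emeasure_eq_measure ennreal_less_iff)
    have "measure M (B - C) = measure M B - measure M C"
      using B C by (intro finite_measure_Diff) auto
    show ?thesis
    proof (cases "measure M C \<le> measure M B / 2")
      case True
      with B C C' show ?thesis by (intro bexI[of _ C]) auto
    next
      case False
      with B C C' \<open>measure M (B - C) = _\<close> show ?thesis by (intro bexI[of _ "B - C"]) auto
    qed
  qed
  have "\<exists>B\<in>sets M. B \<subseteq> A \<and> 0 < measure M B \<and> measure M B \<le> measure M A / 2 ^ n" for n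
  proof (induction n)
    case 0
    then show ?case using A by auto
  next
    case (Suc n)
    then obtain B where B: "B \<in> sets M" "B \<subseteq> A" "0 < measure M B" "measure M B \<le> measure M A / 2 ^ n"
      by blast
    obtain C where C: "C \<in> sets M" "C \<subseteq> B" "0 < measure M C" "measure M C \<le> measure M B / 2"
      using half[OF B(1,3)] by blast
    note C(4)
    also have "measure M B / 2 \<le> measure M A / 2 ^ n / 2" using B by (intro divide_right_mono) auto
    finally have "measure M C \<le> measure M A / 2 ^ Suc n" by (simp add: mult.commute)
    with B C show ?case by (intro bexI[of _ C]) auto
  qed
  moreover obtain n where "measure M A / 2 ^ n < e"
  proof -
    have "(\<lambda>n. measure M A / 2 ^ n) \<longlonglongrightarrow> 0"
      by (rule LIMSEQ_divide_realpow_zero) simp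
    then have "\<forall>\<^sub>F n in sequentially. measure M A / 2 ^ n < e"
      using e by (rule order_tendstoD)
    then show ?thesis using that eventually_happens'[OF sequentially_bot] by blast
  qed
  ultimately show ?thesis by (metis less_imp_le order_trans)
qed

text \<open>Sierpinski's theorem; each greedy step exhausts at least half of what still fits.\<close>

lemma (in finite_measure) atomless_subset:
  assumes atomless: "atomless M" and A: "A \<in> sets M" and t: "0 \<le> t" "t \<le> measure M A"
  shows "\<exists>B\<in>sets M. B \<subseteq> A \<and> measure M B = t"
proof -
  define P where "P B \<longleftrightarrow> B \<in> sets M \<and> B \<subseteq> A \<and> measure M B \<le> t" for B
  \<comment> \<open>The enlargement from \<open>B\<close> to \<open>B'\<close> has at least half the
    measure of any set that could still be added. The supremum of these measures need not be
    attained, hence the factor 2.\<close>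
  define Q where "Q B B' \<longleftrightarrow> B \<subseteq> B' \<and> (\<forall>C\<in>sets M. C \<subseteq> A - B \<and> measure M B + measure M C \<le> t \<longrightarrow>
      measure M C \<le> 2 * (measure M B' - measure M B))" for B B'
  have "\<exists>f. \<forall>n. P (f n) \<and> Q (f n) (f (Suc n))"
  proof (rule dependent_nat_choice)
    show "\<exists>B. P B" using t by (intro exI[of _ "{}"]) (auto simp: P_def)
  next
    fix B :: "'a set" and n :: nat
    assume B: "P B"
    define S where "S = {measure M C | C. C \<in> sets M \<and> C \<subseteq> A - B \<and> measure M B + measure M C \<le> t}"
    have bdd: "bdd_above S"
      unfolding S_def by (intro bdd_aboveI[of _ t]) (auto intro: order_trans[rotated] simp: measure_nonneg)
    have "0 \<in> S" using B unfolding S_def P_def by (auto intro!: exI[of _ "{}"])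
    then have Sup: "0 \<le> Sup S" by (intro cSup_upper bdd)
    obtain c where c: "c \<in> S" "Sup S / 2 \<le> c"
    proof (cases "Sup S = 0")
      case True
      with \<open>0 \<in> S\<close> that show ?thesis by auto
    next
      case False
      with Sup have "Sup S / 2 < Sup S" by simp
      then obtain c where "c \<in> S" "Sup S / 2 < c"
        using less_cSupD[of S "Sup S / 2"] \<open>0 \<in> S\<close> by auto
      then show ?thesis using that[of c] by simp
    qed
    then obtain C where C: "C \<in> sets M" "C \<subseteq> A - B" "measure M B + measure M C \<le> t" "c = measure M C"
      by (auto simp: S_def)
    have m: "measure M (B \<union> C) = measure M B + measure M C"
      using B C by (intro finite_measure_Union) (auto simp: P_def)
    have "measure M C' \<le> 2 * measure M C"
      if "C' \<in> sets M" "C' \<subseteq> A - B" "measure M B + measure M C' \<le> t" for C'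
    proof -
      have "measure M C' \<le> Sup S" using that by (intro cSup_upper bdd) (auto simp: S_def)
      then show ?thesis using c C by simp
    qed
    then show "\<exists>B'. P B' \<and> Q B B'"
      using B C m by (intro exI[of _ "B \<union> C"]) (auto simp: P_def Q_def)
  qed
  then obtain f where f: "\<And>n. P (f n)" "\<And>n. Q (f n) (f (Suc n))" by blast
  define B where "B = (\<Union>n. f n)"
  have B: "B \<in> sets M" "B \<subseteq> A" using f(1) by (auto simp: B_def P_def)
  have "incseq f" using f(2) by (intro incseq_SucI) (auto simp: Q_def)
  then have lim: "(\<lambda>n. measure M (f n)) \<longlonglongrightarrow> measure M B"
    unfolding B_def using f(1) by (intro finite_Lim_measure_incseq) (auto simp: P_def)
  then have le: "measure M B \<le> t"
    using f(1) by (intro LIMSEQ_le_const2) (auto simp: P_def)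
  have "\<not> measure M B < t"
  proof
    assume lt: "measure M B < t"
    have "measure M (A - B) = measure M A - measure M B"
      using A B by (intro finite_measure_Diff) auto
    then obtain C where C: "C \<in> sets M" "C \<subseteq> A - B" "0 < measure M C" "measure M C \<le> t - measure M B"
      using atomless_small_subset[OF atomless, of "A - B" "t - measure M B"] A B lt t by auto
    \<comment> \<open>A set that fits beside the limit fits at every stage, so its measure is at
      most twice increments that tend to 0.\<close>
    have "measure M C \<le> 2 * (measure M (f (Suc n)) - measure M (f n))" for n
    proof -
      have "measure M (f n) \<le> measure M B"
        using B by (intro finite_measure_mono) (auto simp: B_def)
      moreover have "C \<subseteq> A - f n" using C(2) by (auto simp: B_def)
      ultimately show ?thesis using f(2)[of n] C unfolding Q_def by auto
    qed
    moreover have "(\<lambda>n. 2 * (measure M (f (Suc n)) - measure M (f n))) \<longlonglongrightarrow> 2 * (measure M B - measure M B)"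
      by (intro tendsto_intros lim LIMSEQ_Suc)
    ultimately have "measure M C \<le> 2 * (measure M B - measure M B)"
      by (intro LIMSEQ_le_const) auto
    with C(3) show False by simp
  qed
  with le have "measure M B = t" by simp
  with B show ?thesis by (intro bexI[of _ B]) auto
qed

text \<open>Probabilities are inserted in increasing order, so each new event only has to enlarge
  the largest one present by a piece of the missing probability.\<close>

lemma (in prob_space) atomless_chain:
  assumes atomless: "atomless M" and T: "finite T" "T \<subseteq> {0..1}"
  obtains A where "\<And>t. t \<in> T \<Longrightarrow> A t \<in> events" "\<And>t. t \<in> T \<Longrightarrow> prob (A t) = t"
    "\<And>s t. s \<in> T \<Longrightarrow> t \<in> T \<Longrightarrow> s \<le> t \<Longrightarrow> A s \<subseteq> A t"
proof -
  have "\<exists>A. (\<forall>t\<in>T. A t \<in> events \<and> prob (A t) = t) \<and> (\<forall>s\<in>T. \<forall>t\<in>T. s \<le> t \<longrightarrow> A s \<subseteq> A t)"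
    using T
  proof (induction T rule: finite_linorder_max_induct)
    case (insert b T)
    then have "\<exists>A. (\<forall>t\<in>T. A t \<in> events \<and> prob (A t) = t) \<and> (\<forall>s\<in>T. \<forall>t\<in>T. s \<le> t \<longrightarrow> A s \<subseteq> A t)"
      by simp
    then obtain A where A: "\<And>t. t \<in> T \<Longrightarrow> A t \<in> events \<and> prob (A t) = t"
      "\<And>s t. s \<in> T \<Longrightarrow> t \<in> T \<Longrightarrow> s \<le> t \<Longrightarrow> A s \<subseteq> A t" by blast
    obtain C where C: "C \<in> events" "prob C \<le> b" "\<And>t. t \<in> T \<Longrightarrow> A t \<subseteq> C"
    proof (cases "T = {}")
      case True
      show ?thesis using insert.prems True by (intro that[of "{}"]) auto
    next
      case False
      then have "Max T \<in> T" using insert.hyps by simp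
      then show ?thesis
        using A insert.hyps by (intro that[of "A (Max T)"]) (auto simp: less_imp_le)
    qed
    have "prob (space M - C) = 1 - prob C" using C by (simp add: prob_compl)
    then obtain D where D: "D \<in> events" "D \<subseteq> space M - C" "prob D = b - prob C"
      using atomless_subset[OF atomless, of "space M - C" "b - prob C"] C insert.prems by auto
    have "prob (C \<union> D) = b"
      using C D by (subst finite_measure_Union) auto
    moreover have "s \<noteq> b" "\<not> b \<le> s" if "s \<in> T" for s
      using insert.hyps(2) that by auto
    ultimately show ?case
      using A C D by (intro exI[of _ "A(b := C \<union> D)"]) (auto simp: le_supI1)
  qed auto
  then show ?thesis using that by blast
qed

section \<open>Laws of discrete random variables\<close>

lemma (in prob_space) distr_comp_eqI:
  fixes c c' :: "'a \<Rightarrow> nat" and w :: "nat \<Rightarrow> real"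
  assumes [measurable]: "c \<in> measurable M (count_space UNIV)" "c' \<in> measurable M (count_space UNIV)"
    and eq: "\<And>k. prob {\<omega>\<in>space M. c \<omega> = k} = prob {\<omega>\<in>space M. c' \<omega> = k}"
  shows "distr M borel (\<lambda>\<omega>. w (c \<omega>)) = distr M borel (\<lambda>\<omega>. w (c' \<omega>))"
proof -
  have "distr M (count_space UNIV) c = distr M (count_space UNIV) c'"
  proof (rule measure_eqI_countable[where A = UNIV])
    fix k
    have "c -` {k} \<inter> space M = {\<omega>\<in>space M. c \<omega> = k}" "c' -` {k} \<inter> space M = {\<omega>\<in>space M. c' \<omega> = k}"
      by auto
    then show "emeasure (distr M (count_space UNIV) c) {k} = emeasure (distr M (count_space UNIV) c') {k}"
      using eq[of k] by (simp add: emeasure_distr emeasure_eq_measure)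
  qed auto
  then have "distr (distr M (count_space UNIV) c) borel w = distr (distr M (count_space UNIV) c') borel w"
    by simp
  then show ?thesis by (simp add: distr_distr comp_def)
qed

text \<open>Point masses are differences of consecutive tails, and tails are what a chain of events
  provides directly.\<close>

lemma (in prob_space) distr_comp_eqI_tail:
  fixes c c' :: "'a \<Rightarrow> nat" and w :: "nat \<Rightarrow> real"
  assumes [measurable]: "c \<in> measurable M (count_space UNIV)" "c' \<in> measurable M (count_space UNIV)"
    and eq: "\<And>k. prob {\<omega>\<in>space M. k \<le> c \<omega>} = prob {\<omega>\<in>space M. k \<le> c' \<omega>}"
  shows "distr M borel (\<lambda>\<omega>. w (c \<omega>)) = distr M borel (\<lambda>\<omega>. w (c' \<omega>))"
proof (rule distr_comp_eqI)
  have split: "prob {\<omega>\<in>space M. d \<omega> = k} = prob {\<omega>\<in>space M. k \<le> d \<omega>} - prob {\<omega>\<in>space M. Suc k \<le> d \<omega>}"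
    if [measurable]: "d \<in> measurable M (count_space UNIV)" for d k
  proof -
    have "prob ({\<omega>\<in>space M. k \<le> d \<omega>} - {\<omega>\<in>space M. Suc k \<le> d \<omega>})
        = prob {\<omega>\<in>space M. k \<le> d \<omega>} - prob {\<omega>\<in>space M. Suc k \<le> d \<omega>}"
      by (intro finite_measure_Diff) auto
    also have "{\<omega>\<in>space M. k \<le> d \<omega>} - {\<omega>\<in>space M. Suc k \<le> d \<omega>} = {\<omega>\<in>space M. d \<omega> = k}"
      by auto
    finally show ?thesis .
  qed
  show "prob {\<omega>\<in>space M. c \<omega> = k} = prob {\<omega>\<in>space M. c' \<omega> = k}" for k
    using eq by (simp add: split)
qed (fact assms(1,2))+

text \<open>In an increasing chain the indices of the events containing \<open>\<omega>\<close> form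
  a final segment of \<open>{..<m}\<close>; it has at least \<open>k\<close> elements exactly when
  it contains \<open>m - k\<close>.\<close>

lemma le_card_nested_iff:
  fixes S :: "nat \<Rightarrow> 'a set"
  assumes S: "\<And>i j. i \<le> j \<Longrightarrow> j < m \<Longrightarrow> S i \<subseteq> S j" and k: "1 \<le> k" "k \<le> m"
  shows "k \<le> card {j. j < m \<and> \<omega> \<in> S j} \<longleftrightarrow> \<omega> \<in> S (m - k)"
proof
  assume "\<omega> \<in> S (m - k)"
  then have "{m - k..<m} \<subseteq> {j. j < m \<and> \<omega> \<in> S j}" using S by fastforce
  then have "card {m - k..<m} \<le> card {j. j < m \<and> \<omega> \<in> S j}" by (intro card_mono) auto
  then show "k \<le> card {j. j < m \<and> \<omega> \<in> S j}" using k by simp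
next
  assume le: "k \<le> card {j. j < m \<and> \<omega> \<in> S j}"
  show "\<omega> \<in> S (m - k)"
  proof (rule ccontr)
    assume "\<omega> \<notin> S (m - k)"
    then have "m - k < j" if "j < m" "\<omega> \<in> S j" for j
      using S[of j "m - k"] that k by (cases "m - k < j") auto
    then have "{j. j < m \<and> \<omega> \<in> S j} \<subseteq> {Suc (m - k)..<m}"
      by (auto simp del: Suc_diff_le intro!: Suc_leI)
    then have "card {j. j < m \<and> \<omega> \<in> S j} \<le> card {Suc (m - k)..<m}" by (intro card_mono) auto
    with le k show False by simp
  qed
qed

lemma measurable_card_levels[measurable]:
  fixes S :: "nat \<Rightarrow> 'a set"
  assumes "\<And>j. j < m \<Longrightarrow> S j \<in> sets M"
  shows "(\<lambda>\<omega>. card {j. j < m \<and> \<omega> \<in> S j}) \<in> measurable M (count_space UNIV)"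
proof -
  have "card {j. j < m \<and> \<omega> \<in> S j} = (\<Sum>j<m. if \<omega> \<in> S j then 1 else 0)" for \<omega>
    by (simp add: sum.If_cases Int_def)
  moreover have "(\<lambda>\<omega>. \<Sum>j<n. if \<omega> \<in> S j then 1 else 0 :: nat) \<in> measurable M (count_space UNIV)"
    if "n \<le> m" for n
    using that
  proof (induction n)
    case (Suc n)
    then have [measurable]: "S n \<in> sets M" using assms by simp
    have [measurable]: "(\<lambda>\<omega>. \<Sum>j<n. if \<omega> \<in> S j then 1 else 0 :: nat) \<in> measurable M (count_space UNIV)"
      using Suc by simp
    show ?case by simp
  qed simp
  ultimately show ?thesis by simp
qed

text \<open>For \<open>1 \<le> k \<le> m\<close> the event that the count is at least
  \<open>k\<close> is \<open>S (m - k)\<close> itself, so the probabilities of the chain determine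
  the law of the count.\<close>

lemma (in prob_space) distr_card_nested_eq:
  fixes w :: "nat \<Rightarrow> real" and S S' :: "nat \<Rightarrow> 'a set"
  assumes S: "\<And>j. j < m \<Longrightarrow> S j \<in> events" "\<And>i j. i \<le> j \<Longrightarrow> j < m \<Longrightarrow> S i \<subseteq> S j"
    and S': "\<And>j. j < m \<Longrightarrow> S' j \<in> events" "\<And>i j. i \<le> j \<Longrightarrow> j < m \<Longrightarrow> S' i \<subseteq> S' j"
    and eq: "\<And>j. j < m \<Longrightarrow> prob (S j) = prob (S' j)"
  shows "distr M borel (\<lambda>\<omega>. w (card {j. j < m \<and> \<omega> \<in> S j})) =
    distr M borel (\<lambda>\<omega>. w (card {j. j < m \<and> \<omega> \<in> S' j}))"
proof (rule distr_comp_eqI_tail[OF measurable_card_levels[OF S(1)] measurable_card_levels[OF S'(1)]])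
  have card_le: "card {j. j < m \<and> \<omega> \<in> R j} \<le> m" for \<omega> and R :: "nat \<Rightarrow> 'a set"
    using card_mono[of "{..<m}" "{j. j < m \<and> \<omega> \<in> R j}"] by auto
  have tail: "prob {\<omega>\<in>space M. k \<le> card {j. j < m \<and> \<omega> \<in> R j}} =
      (if k = 0 then 1 else if k \<le> m then prob (R (m - k)) else 0)"
    if R: "\<And>j. j < m \<Longrightarrow> R j \<in> events" "\<And>i j. i \<le> j \<Longrightarrow> j < m \<Longrightarrow> R i \<subseteq> R j"
    for R :: "nat \<Rightarrow> 'a set" and k
  proof -
    consider "k = 0" | "1 \<le> k" "k \<le> m" | "m < k" by linarith
    then show ?thesis
    proof cases
      case 1
      then show ?thesis by (simp add: prob_space)
    next
      case 2
      then have "{\<omega>\<in>space M. k \<le> card {j. j < m \<and> \<omega> \<in> R j}} = R (m - k)"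
        using le_card_nested_iff[of m R k, OF R(2)] R(1)[of "m - k"] sets.sets_into_space by auto
      with 2 show ?thesis by simp
    next
      case 3
      then have "{\<omega>\<in>space M. k \<le> card {j. j < m \<and> \<omega> \<in> R j}} = {}"
        using card_le[of _ R] by (auto simp: not_le intro: le_less_trans)
      then have "prob {\<omega>\<in>space M. k \<le> card {j. j < m \<and> \<omega> \<in> R j}} = 0"
        by (simp only: measure_empty)
      with 3 show ?thesis by simp
    qed
  qed
  show "prob {\<omega>\<in>space M. k \<le> card {j. j < m \<and> \<omega> \<in> S j}} =
      prob {\<omega>\<in>space M. k \<le> card {j. j < m \<and> \<omega> \<in> S' j}}" for k
    by (simp add: tail[OF S] tail[OF S'] eq)
qed

text \<open>One chain is built for \<open>T\<close> and the grid probabilities \<open>k / N\<close>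
  together. The index \<open>\<iota>\<close> numbers the cells between consecutive grid events and
  is uniform on \<open>{..<N}\<close>; each \<open>A t\<close> lies inside every grid event of
  probability at least \<open>t\<close>.\<close>

lemma (in prob_space) atomless_levels:
  fixes N :: nat
  assumes atomless: "atomless M" and T: "finite T" "T \<subseteq> {0..1}" and N: "N > 0"
  obtains A \<iota> where "\<And>t. t \<in> T \<Longrightarrow> A t \<in> events" "\<And>t. t \<in> T \<Longrightarrow> prob (A t) = t"
    "\<And>s t. s \<in> T \<Longrightarrow> t \<in> T \<Longrightarrow> s \<le> t \<Longrightarrow> A s \<subseteq> A t"
    "\<iota> \<in> measurable M (count_space UNIV)" "\<And>\<omega>. \<omega> \<in> space M \<Longrightarrow> \<iota> \<omega> < N"
    "\<And>k. k \<le> N \<Longrightarrow> prob {\<omega>\<in>space M. \<iota> \<omega> < k} = real k / real N"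
    "\<And>t k. t \<in> T \<Longrightarrow> k \<le> N \<Longrightarrow> t \<le> real k / real N \<Longrightarrow> A t \<subseteq> {\<omega>\<in>space M. \<iota> \<omega> < k}"
proof -
  define T' where "T' = T \<union> (\<lambda>k. real k / real N) ` {..N} \<union> {0, 1}"
  have T': "finite T'" "T' \<subseteq> {0..1}" using T N by (auto simp: T'_def)
  obtain A0 where A0: "\<And>t. t \<in> T' \<Longrightarrow> A0 t \<in> events" "\<And>t. t \<in> T' \<Longrightarrow> prob (A0 t) = t"
    "\<And>s t. s \<in> T' \<Longrightarrow> t \<in> T' \<Longrightarrow> s \<le> t \<Longrightarrow> A0 s \<subseteq> A0 t"
    using atomless_chain[OF atomless T'] by blast
  \<comment> \<open>The events of probability 0 and 1 are replaced by the empty set and the whole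
    space, so that \<open>\<iota>\<close> stays below \<open>N\<close> everywhere and not only
    almost surely.\<close>
  define A where "A t = (if t = 0 then {} else if t = 1 then space M else A0 t)" for t :: real
  have A: "A t \<in> events" "prob (A t) = t" if "t \<in> T'" for t
    using A0(1,2)[OF that] by (auto simp: A_def prob_space)
  have mono: "A s \<subseteq> A t" if "s \<in> T'" "t \<in> T'" "s \<le> t" for s t
  proof (cases "s = 0 \<or> t = 1")
    case True
    then show ?thesis using sets.sets_into_space[OF A(1)[OF that(1)]] by (auto simp: A_def)
  next
    case False
    with that T'(2) have "0 < s" "s \<noteq> 1" "t \<noteq> 0" by force+
    with False show ?thesis using A0(3)[OF that] by (auto simp: A_def)
  qed
  \<comment> \<open>\<open>B i\<close> is the union of the cells up to \<open>i\<close>. From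
    \<open>N - 1\<close> on it is the whole space, so the least index exists at every point of the
    space.\<close>
  define B where "B i = (if Suc i < N then A (real (Suc i) / real N) else space M)" for i
  define \<iota> where "\<iota> \<omega> = (LEAST i. \<omega> \<in> B i)" for \<omega>
  have inT: "real k / real N \<in> T'" if "k \<le> N" for k using that by (auto simp: T'_def)
  have [measurable]: "B i \<in> events" for i
    using A(1)[OF inT[of "Suc i"]] by (auto simp: B_def)
  have meas: "\<iota> \<in> measurable M (count_space UNIV)"
    unfolding \<iota>_def by measurable
  have B_A: "B i = A (real (Suc i) / real N)" if "Suc i \<le> N" for i
    using that N by (cases "Suc i = N") (auto simp: B_def A_def)
  have iff: "\<iota> \<omega> < k \<longleftrightarrow> \<omega> \<in> A (real k / real N)" if "\<omega> \<in> space M" "k \<le> N" for \<omega> k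
  proof
    assume lt: "\<iota> \<omega> < k"
    have "\<omega> \<in> B (N - 1)" using that N by (simp add: B_def)
    then have "\<omega> \<in> B (\<iota> \<omega>)" unfolding \<iota>_def by (rule LeastI)
    then have "\<omega> \<in> A (real (Suc (\<iota> \<omega>)) / real N)" using B_A[of "\<iota> \<omega>"] lt that by simp
    moreover have "A (real (Suc (\<iota> \<omega>)) / real N) \<subseteq> A (real k / real N)"
      using lt that N by (intro mono inT divide_right_mono) auto
    ultimately show "\<omega> \<in> A (real k / real N)" by blast
  next
    assume in_A: "\<omega> \<in> A (real k / real N)"
    then obtain i where i: "k = Suc i" by (cases k) (auto simp: A_def)
    then have "\<omega> \<in> B i" using in_A B_A[of i] that by simp
    then have "\<iota> \<omega> \<le> i" unfolding \<iota>_def by (rule Least_le)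
    then show "\<iota> \<omega> < k" using i by simp
  qed
  have lt_set: "{\<omega>\<in>space M. \<iota> \<omega> < k} = A (real k / real N)" if "k \<le> N" for k
    using iff[OF _ that] sets.sets_into_space[OF A(1)[OF inT[OF that]]] by blast
  have T_sub: "t \<in> T' " if "t \<in> T" for t using that by (simp add: T'_def)
  show ?thesis
  proof (rule that[of A \<iota>])
    show "\<iota> \<omega> < N" if "\<omega> \<in> space M" for \<omega>
      using iff[OF that order_refl] N that by (simp add: A_def)
    show "prob {\<omega>\<in>space M. \<iota> \<omega> < k} = real k / real N" if "k \<le> N" for k
      unfolding lt_set[OF that] by (rule A(2)[OF inT[OF that]])
    show "A t \<subseteq> {\<omega>\<in>space M. \<iota> \<omega> < k}" if "t \<in> T" "k \<le> N" "t \<le> real k / real N" for t k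
      unfolding lt_set[OF that(2)] using that by (intro mono T_sub inT) auto
    show "A t \<in> events" "prob (A t) = t" if "t \<in> T" for t
      using A[OF T_sub[OF that]] by auto
    show "A s \<subseteq> A t" if "s \<in> T" "t \<in> T" "s \<le> t" for s t
      using that by (intro mono T_sub)
  qed (rule meas)
qed

section \<open>Coherent risk measures\<close>

locale coherent_risk = prob_space M for M :: "'a measure" +
  fixes \<X> :: "('a \<Rightarrow> real) set" and \<rho> :: "('a \<Rightarrow> real) \<Rightarrow> real"
  assumes atomless: "atomless M" and rv_space: "rv_space M \<X>"
    and coherent: "coherent M \<X> \<rho>" and law_invariant: "law_invariant M \<X> \<rho>"
begin

abbreviation g :: "real \<Rightarrow> real" where "g \<equiv> assoc_distortion M \<rho>"

lemma rv_measurable: "X \<in> \<X> \<Longrightarrow> X \<in> borel_measurable M"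
  using rv_space unfolding rv_space_def by blast

lemma rv_add: "X \<in> \<X> \<Longrightarrow> Y \<in> \<X> \<Longrightarrow> (\<lambda>\<omega>. X \<omega> + Y \<omega>) \<in> \<X>"
  and rv_scale: "X \<in> \<X> \<Longrightarrow> (\<lambda>\<omega>. c * X \<omega>) \<in> \<X>"
  using rv_space unfolding rv_space_def by blast+

lemma rv_uminus: "X \<in> \<X> \<Longrightarrow> (\<lambda>\<omega>. - X \<omega>) \<in> \<X>"
  using rv_scale[of X "- 1"] by simp

lemma rv_bounded:
  assumes "X \<in> borel_measurable M" "\<And>\<omega>. \<omega> \<in> space M \<Longrightarrow> \<bar>X \<omega>\<bar> \<le> C"
  shows "X \<in> \<X>"
proof -
  have "X \<in> ess_bounded M"
    using assms by (auto simp: ess_bounded_def intro!: exI[of _ C] AE_I2)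
  then show ?thesis using rv_space by (auto simp: rv_space_def)
qed

lemma rv_const: "(\<lambda>\<omega>. c) \<in> \<X>"
  by (rule rv_bounded[of _ "\<bar>c\<bar>"]) auto

lemma rho_mono:
  assumes "X \<in> \<X>" "Y \<in> \<X>" "\<And>\<omega>. \<omega> \<in> space M \<Longrightarrow> X \<omega> \<le> Y \<omega>"
  shows "\<rho> Y \<le> \<rho> X"
proof -
  have "AE \<omega> in M. X \<omega> \<le> Y \<omega>" using assms(3) by (intro AE_I2)
  then show ?thesis using coherent assms(1,2) unfolding coherent_def by blast
qed

lemma rho_cong:
  assumes "X \<in> \<X>" "Y \<in> \<X>" "\<And>\<omega>. \<omega> \<in> space M \<Longrightarrow> X \<omega> = Y \<omega>"
  shows "\<rho> X = \<rho> Y"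
  using assms by (intro antisym rho_mono) auto

lemma rho_cash: "X \<in> \<X> \<Longrightarrow> \<rho> (\<lambda>\<omega>. X \<omega> + c) = \<rho> X - c"
  and rho_add: "X \<in> \<X> \<Longrightarrow> Y \<in> \<X> \<Longrightarrow> \<rho> (\<lambda>\<omega>. X \<omega> + Y \<omega>) \<le> \<rho> X + \<rho> Y"
  and rho_scale: "X \<in> \<X> \<Longrightarrow> c \<ge> 0 \<Longrightarrow> \<rho> (\<lambda>\<omega>. c * X \<omega>) = c * \<rho> X"
  using coherent unfolding coherent_def by blast+

lemma rho_law: "X \<in> \<X> \<Longrightarrow> Y \<in> \<X> \<Longrightarrow> distr M borel X = distr M borel Y \<Longrightarrow> \<rho> X = \<rho> Y"
  using law_invariant unfolding law_invariant_def by blast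

lemma rho_zero: "\<rho> (\<lambda>\<omega>. 0) = 0"
  using rho_scale[OF rv_const[of 0], of 0] by simp

text \<open>From \<open>X \<ge> Y - Z\<close>, monotonicity and subadditivity give
  \<open>\<rho> X \<le> \<rho> Y + \<rho> (- Z)\<close>; the hypothesis is symmetric in
  \<open>X\<close> and \<open>Y\<close>.\<close>

lemma rho_diff_le:
  assumes "X \<in> \<X>" "Y \<in> \<X>" "Z \<in> \<X>" "\<And>\<omega>. \<omega> \<in> space M \<Longrightarrow> \<bar>X \<omega> - Y \<omega>\<bar> \<le> Z \<omega>"
  shows "\<bar>\<rho> X - \<rho> Y\<bar> \<le> \<rho> (\<lambda>\<omega>. - Z \<omega>)"
proof -
  have *: "\<rho> X - \<rho> Y \<le> \<rho> (\<lambda>\<omega>. - Z \<omega>)"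
    if "X \<in> \<X>" "Y \<in> \<X>" "\<And>\<omega>. \<omega> \<in> space M \<Longrightarrow> \<bar>X \<omega> - Y \<omega>\<bar> \<le> Z \<omega>" for X Y
  proof -
    have "\<rho> X \<le> \<rho> (\<lambda>\<omega>. Y \<omega> + - Z \<omega>)"
      using that assms(3) by (intro rho_mono rv_add rv_uminus) (auto simp: abs_le_iff algebra_simps)
    also have "\<dots> \<le> \<rho> Y + \<rho> (\<lambda>\<omega>. - Z \<omega>)"
      using that assms(3) by (intro rho_add rv_uminus)
    finally show ?thesis by simp
  qed
  show ?thesis
    using *[of X Y] *[of Y X] assms by (simp add: abs_minus_commute)
qed

lemma rho_sum:
  fixes X :: "nat \<Rightarrow> 'a \<Rightarrow> real"
  assumes "\<And>j. j < m \<Longrightarrow> X j \<in> \<X>"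
  shows "(\<lambda>\<omega>. \<Sum>j<m. X j \<omega>) \<in> \<X>" "\<rho> (\<lambda>\<omega>. \<Sum>j<m. X j \<omega>) \<le> (\<Sum>j<m. \<rho> (X j))"
proof -
  have "(\<lambda>\<omega>. \<Sum>j<n. X j \<omega>) \<in> \<X> \<and> \<rho> (\<lambda>\<omega>. \<Sum>j<n. X j \<omega>) \<le> (\<Sum>j<n. \<rho> (X j))"
    if "n \<le> m" for n
    using that
  proof (induction n)
    case 0
    then show ?case using rv_const[of 0] rho_zero by simp
  next
    case (Suc n)
    then show ?case
      using rv_add[of "\<lambda>\<omega>. \<Sum>j<n. X j \<omega>" "X n"] rho_add[of "\<lambda>\<omega>. \<Sum>j<n. X j \<omega>" "X n"] assms[of n]
      by simp
  qed
  then show "(\<lambda>\<omega>. \<Sum>j<m. X j \<omega>) \<in> \<X>" "\<rho> (\<lambda>\<omega>. \<Sum>j<m. X j \<omega>) \<le> (\<Sum>j<m. \<rho> (X j))"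
    by auto
qed

lemma rv_event: "E \<in> events \<Longrightarrow> (\<lambda>\<omega>. - of_bool (\<omega> \<in> E)) \<in> \<X>"
  by (rule rv_bounded[of _ 1]) auto

text \<open>Evaluates the definite description behind \<open>g\<close>: the indicator of any event
  serves as the Bernoulli variable.\<close>

lemma rho_event:
  assumes [measurable]: "E \<in> events"
  shows "\<rho> (\<lambda>\<omega>. - of_bool (\<omega> \<in> E)) = g (prob E)"
proof -
  have "distr M (count_space UNIV) (\<lambda>\<omega>. \<omega> \<in> E) = measure_pmf (bernoulli_pmf (prob E))"
  proof (rule measure_eqI_countable[where A = UNIV])
    fix b
    have "(\<lambda>\<omega>. \<omega> \<in> E) -` {True} \<inter> space M = E" "(\<lambda>\<omega>. \<omega> \<in> E) -` {False} \<inter> space M = space M - E"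
      using sets.sets_into_space[OF assms] by auto
    then show "emeasure (distr M (count_space UNIV) (\<lambda>\<omega>. \<omega> \<in> E)) {b} =
        emeasure (measure_pmf (bernoulli_pmf (prob E))) {b}"
      by (cases b) (simp_all add: emeasure_distr emeasure_pmf_single emeasure_eq_measure prob_compl)
  qed auto
  then have "distr (distr M (count_space UNIV) (\<lambda>\<omega>. \<omega> \<in> E)) borel of_bool =
      distr (measure_pmf (bernoulli_pmf (prob E))) borel (of_bool :: bool \<Rightarrow> real)"
    by simp
  then have "is_bernoulli M (prob E) (\<lambda>\<omega>. of_bool (\<omega> \<in> E))"
    by (simp add: is_bernoulli_def distr_distr comp_def)
  then show ?thesis
    using assoc_distortion_bernoulli[OF rv_space law_invariant] by simp
qed

lemma g_zero: "g 0 = 0"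
  using rho_event[of "{}"] rho_zero by simp

lemma g_mono: "0 \<le> s \<Longrightarrow> s \<le> t \<Longrightarrow> t \<le> 1 \<Longrightarrow> g s \<le> g t"
proof -
  assume st: "0 \<le> s" "s \<le> t" "t \<le> 1"
  obtain A where A: "\<And>r. r \<in> {s, t} \<Longrightarrow> A r \<in> events" "\<And>r. r \<in> {s, t} \<Longrightarrow> prob (A r) = r"
    "\<And>r r'. r \<in> {s, t} \<Longrightarrow> r' \<in> {s, t} \<Longrightarrow> r \<le> r' \<Longrightarrow> A r \<subseteq> A r'"
    by (rule atomless_chain[OF atomless, of "{s, t}"]) (use st in auto)
  have "A s \<subseteq> A t" using A(3) st by simp
  then have "\<rho> (\<lambda>\<omega>. - of_bool (\<omega> \<in> A s)) \<le> \<rho> (\<lambda>\<omega>. - of_bool (\<omega> \<in> A t))"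
    using A(1) by (intro rho_mono rv_event) auto
  then show ?thesis using A by (simp add: rho_event)
qed

lemma g_nonneg: "0 \<le> t \<Longrightarrow> t \<le> 1 \<Longrightarrow> 0 \<le> g t"
  using g_mono[of 0 t] g_zero by simp

text \<open>Up to a constant, a variable rounded to a grid of step \<open>h\<close>: if
  \<open>S j\<close> is the event that the variable is at most the \<open>j\<close>-th grid point,
  the sum counts the grid points at or above it. Keeping the events instead of the values makes
  comparisons possible layer by layer.\<close>

definition level :: "nat \<Rightarrow> real \<Rightarrow> (nat \<Rightarrow> 'a set) \<Rightarrow> 'a \<Rightarrow> real" where
  "level m h S \<omega> = - (h * (\<Sum>j<m. of_bool (\<omega> \<in> S j)))"

lemma rv_level:
  assumes "\<And>j. j < m \<Longrightarrow> S j \<in> events"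
  shows "level m h S \<in> \<X>"
proof -
  have "(\<lambda>\<omega>. \<Sum>j<m. - of_bool (\<omega> \<in> S j)) \<in> \<X>"
    using assms by (intro rho_sum(1) rv_event)
  from rv_scale[OF this, of h] show ?thesis
    by (simp add: level_def[abs_def] sum_negf)
qed

lemma rho_level_eq:
  assumes S: "\<And>j. j < m \<Longrightarrow> S j \<in> events" "\<And>i j. i \<le> j \<Longrightarrow> j < m \<Longrightarrow> S i \<subseteq> S j"
    and S': "\<And>j. j < m \<Longrightarrow> S' j \<in> events" "\<And>i j. i \<le> j \<Longrightarrow> j < m \<Longrightarrow> S' i \<subseteq> S' j"
    and eq: "\<And>j. j < m \<Longrightarrow> prob (S j) = prob (S' j)"
  shows "\<rho> (level m h S) = \<rho> (level m h S')"
proof (rule rho_law[OF rv_level[OF S(1)] rv_level[OF S'(1)]])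
  have card: "(\<Sum>j<m. of_bool (\<omega> \<in> R j)) = real (card {j. j < m \<and> \<omega> \<in> R j})"
    for \<omega> and R :: "nat \<Rightarrow> 'a set"
    by (simp add: of_bool_def sum.If_cases Int_def)
  have "distr M borel (\<lambda>\<omega>. - (h * real (card {j. j < m \<and> \<omega> \<in> S j}))) =
      distr M borel (\<lambda>\<omega>. - (h * real (card {j. j < m \<and> \<omega> \<in> S' j})))"
    by (rule distr_card_nested_eq) (fact S S' eq)+
  then show "distr M borel (level m h S) = distr M borel (level m h S')"
    unfolding level_def[abs_def] card .
qed

lemma rho_level_mono:
  assumes "\<And>j. j < m \<Longrightarrow> S j \<in> events" "\<And>j. j < m \<Longrightarrow> S' j \<in> events"
    and "\<And>j. j < m \<Longrightarrow> S j \<subseteq> S' j" and h: "h \<ge> 0"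
  shows "\<rho> (level m h S) \<le> \<rho> (level m h S')"
proof (rule rho_mono[OF rv_level[OF assms(2)] rv_level[OF assms(1)]])
  fix \<omega>
  have "(\<Sum>j<m. of_bool (\<omega> \<in> S j)) \<le> (\<Sum>j<m. of_bool (\<omega> \<in> S' j) :: real)"
    using assms(3) by (intro sum_mono) auto
  then show "level m h S' \<omega> \<le> level m h S \<omega>"
    unfolding level_def using h by (simp add: mult_left_mono)
qed

text \<open>The price of rounding: the two variables differ by \<open>h\<close> times
  \<open>m\<close> indicators of events of probability at most \<open>\<eta>\<close>, and
  subadditivity charges at most \<open>h * g \<eta>\<close> for each.\<close>

lemma rho_level_diff:
  assumes S: "\<And>j. j < m \<Longrightarrow> S j \<in> events" "\<And>j. j < m \<Longrightarrow> S' j \<in> events"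
    and sub: "\<And>j. j < m \<Longrightarrow> S j \<subseteq> S' j" and h: "h \<ge> 0"
    and \<eta>: "\<And>j. j < m \<Longrightarrow> prob (S' j) - prob (S j) \<le> \<eta>" "\<eta> \<le> 1"
  shows "\<rho> (level m h S') \<le> \<rho> (level m h S) + real m * h * g \<eta>"
proof -
  define D where "D j = S' j - S j" for j
  have D: "D j \<in> events" "g (prob (D j)) \<le> g \<eta>" if "j < m" for j
  proof -
    show "D j \<in> events" using S that by (auto simp: D_def)
    have "prob (D j) = prob (S' j) - prob (S j)"
      unfolding D_def using S sub that by (intro finite_measure_Diff) auto
    then have "prob (D j) \<le> \<eta>" using \<eta> that by simp
    then show "g (prob (D j)) \<le> g \<eta>" using \<eta>(2) by (intro g_mono) auto
  qed
  have split: "level m h S' \<omega> = level m h S \<omega> + h * (\<Sum>j<m. - of_bool (\<omega> \<in> D j))" for \<omega>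
  proof -
    have "(\<Sum>j<m. of_bool (\<omega> \<in> S' j)) = (\<Sum>j<m. of_bool (\<omega> \<in> S j) + of_bool (\<omega> \<in> D j) :: real)"
      using sub by (intro sum.cong) (auto simp: D_def)
    then show ?thesis by (simp add: level_def sum.distrib sum_negf algebra_simps)
  qed
  have rv: "(\<lambda>\<omega>. \<Sum>j<m. - of_bool (\<omega> \<in> D j)) \<in> \<X>"
    using D by (intro rho_sum(1) rv_event)
  have "\<rho> (level m h S') = \<rho> (\<lambda>\<omega>. level m h S \<omega> + h * (\<Sum>j<m. - of_bool (\<omega> \<in> D j)))"
    by (simp add: split[abs_def])
  also have "\<dots> \<le> \<rho> (level m h S) + \<rho> (\<lambda>\<omega>. h * (\<Sum>j<m. - of_bool (\<omega> \<in> D j)))"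
    using S by (intro rho_add rv_level rv_scale rv)
  also have "\<rho> (\<lambda>\<omega>. h * (\<Sum>j<m. - of_bool (\<omega> \<in> D j))) = h * \<rho> (\<lambda>\<omega>. \<Sum>j<m. - of_bool (\<omega> \<in> D j))"
    using h by (intro rho_scale rv)
  also have "\<dots> \<le> h * (\<Sum>j<m. g \<eta>)"
    using D h by (intro mult_left_mono order_trans[OF rho_sum(2)] sum_mono) (auto simp: rv_event rho_event)
  finally show ?thesis by (simp add: algebra_simps)
qed

text \<open>Levels are rounded up to multiples of \<open>1 / N\<close> and realised through a uniform index
  \<open>\<iota>\<close>; \<open>\<rho>\<close> restricted to functions of \<open>\<iota>\<close> is then permutation-invariant.\<close>

lemma rho_level_rounded:
  fixes N :: nat
  assumes S: "\<And>j. j < m \<Longrightarrow> S j \<in> events" "\<And>i j. i \<le> j \<Longrightarrow> j < m \<Longrightarrow> S i \<subseteq> S j"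
    and S': "\<And>j. j < m \<Longrightarrow> S' j \<in> events" "\<And>i j. i \<le> j \<Longrightarrow> j < m \<Longrightarrow> S' i \<subseteq> S' j"
    and h: "h \<ge> 0" and N: "N > 0"
    and bound: "\<And>q j. antimono q \<Longrightarrow> (\<And>i. q i \<ge> 0) \<Longrightarrow>
      (\<And>k. k \<le> N \<Longrightarrow> (\<Sum>i<k. q i) \<le> g (real k / real N)) \<Longrightarrow> j < m \<Longrightarrow>
      (\<Sum>i<nat \<lceil>real N * prob (S j)\<rceil>. q i) - (\<Sum>i<nat \<lceil>real N * prob (S' j)\<rceil>. q i) \<le> \<beta> j"
  shows "\<rho> (level m h S) - \<rho> (level m h S') \<le> h * (\<Sum>j<m. \<beta> j) + real m * h * g (1 / real N)"
proof -
  define u where "u j = prob (S j)" for j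
  define v where "v j = prob (S' j)" for j
  define a where "a j = nat \<lceil>real N * u j\<rceil>" for j
  define b where "b j = nat \<lceil>real N * v j\<rceil>" for j
  have round: "nat \<lceil>real N * t\<rceil> \<le> N" "t \<le> real (nat \<lceil>real N * t\<rceil>) / real N"
    "real (nat \<lceil>real N * t\<rceil>) / real N - t \<le> 1 / real N" if "0 \<le> t" "t \<le> 1" for t
  proof -
    have "real N * t \<le> real N * 1" using that by (intro mult_left_mono) auto
    then show "nat \<lceil>real N * t\<rceil> \<le> N" by linarith
    have nn: "0 \<le> real N * t" using that by simp
    then have "real N * t \<le> real (nat \<lceil>real N * t\<rceil>)" "real (nat \<lceil>real N * t\<rceil>) \<le> real N * t + 1"
      by linarith+
    then have "real N * t / real N \<le> real (nat \<lceil>real N * t\<rceil>) / real N"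
      "real (nat \<lceil>real N * t\<rceil>) / real N \<le> (real N * t + 1) / real N"
      by (intro divide_right_mono; simp)+
    then show "t \<le> real (nat \<lceil>real N * t\<rceil>) / real N"
      "real (nat \<lceil>real N * t\<rceil>) / real N - t \<le> 1 / real N"
      using N by (auto simp: add_divide_distrib)
  qed
  have aN: "a j \<le> N" and bN: "b j \<le> N" for j
    unfolding a_def b_def u_def v_def by (intro round; simp)+
  define T where "T = u ` {..<m} \<union> v ` {..<m}"
  have T: "finite T" "T \<subseteq> {0..1}" by (auto simp: T_def u_def v_def)
  obtain A \<iota> where A: "\<And>t. t \<in> T \<Longrightarrow> A t \<in> events" "\<And>t. t \<in> T \<Longrightarrow> prob (A t) = t"
    "\<And>s t. s \<in> T \<Longrightarrow> t \<in> T \<Longrightarrow> s \<le> t \<Longrightarrow> A s \<subseteq> A t"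
    and \<iota>[measurable]: "\<iota> \<in> measurable M (count_space UNIV)" and \<iota>_lt: "\<And>\<omega>. \<omega> \<in> space M \<Longrightarrow> \<iota> \<omega> < N"
    and \<iota>_prob: "\<And>k. k \<le> N \<Longrightarrow> prob {\<omega>\<in>space M. \<iota> \<omega> < k} = real k / real N"
    and \<iota>_sub: "\<And>t k. t \<in> T \<Longrightarrow> k \<le> N \<Longrightarrow> t \<le> real k / real N \<Longrightarrow> A t \<subseteq> {\<omega>\<in>space M. \<iota> \<omega> < k}"
    using atomless_levels[OF atomless T N] by blast
  have uT: "u j \<in> T" and vT: "v j \<in> T" if "j < m" for j using that by (auto simp: T_def)
  have u_mono: "u i \<le> u j" and v_mono: "v i \<le> v j" if "i \<le> j" "j < m" for i j
    unfolding u_def v_def by (intro finite_measure_mono S S' that)+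
  define E where "E k = {\<omega>\<in>space M. \<iota> \<omega> < k}" for k
  have E: "E k \<in> events" for k unfolding E_def by measurable
  define p where "p z = \<rho> (\<lambda>\<omega>. - z (\<iota> \<omega>))" for z :: "nat \<Rightarrow> real"
  have rv: "(\<lambda>\<omega>. - z (\<iota> \<omega>)) \<in> \<X>" for z :: "nat \<Rightarrow> real"
  proof (rule rv_bounded)
    show "\<bar>- z (\<iota> \<omega>)\<bar> \<le> (\<Sum>i<N. \<bar>z i\<bar>)" if "\<omega> \<in> space M" for \<omega>
      using member_le_sum[of "\<iota> \<omega>" "{..<N}" "\<lambda>i. \<bar>z i\<bar>"] \<iota>_lt[OF that] by auto
    have "z \<in> measurable (count_space UNIV) borel" by simp
    then show "(\<lambda>\<omega>. - z (\<iota> \<omega>)) \<in> borel_measurable M" by measurable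
  qed
  have sub: "sublinear p"
    unfolding sublinear_def
  proof (intro conjI allI impI)
    show "p (\<lambda>i. x i + y i) \<le> p x + p y" for x y
      using rho_add[OF rv[of x] rv[of y]] by (simp add: p_def algebra_simps)
    show "p (\<lambda>i. c * x i) = c * p x" if "0 \<le> c" for x c
      using rho_scale[OF rv[of x] that] by (simp add: p_def)
  qed
  have cong: "p z = p w" if "\<And>i. i < N \<Longrightarrow> z i = w i" for z w
    unfolding p_def using that \<iota>_lt by (intro rho_cong rv) auto
  have \<iota>_eq: "prob {\<omega>\<in>space M. \<iota> \<omega> = k} = (if k < N then 1 / real N else 0)" for k
  proof (cases "k < N")
    case True
    have "prob (E (Suc k) - E k) = prob (E (Suc k)) - prob (E k)"
      using E by (intro finite_measure_Diff) (auto simp: E_def)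
    also have "E (Suc k) - E k = {\<omega>\<in>space M. \<iota> \<omega> = k}" by (auto simp: E_def)
    finally show ?thesis
      using \<iota>_prob[of k] \<iota>_prob[of "Suc k"] True N by (simp add: E_def field_simps)
  next
    case False
    then have "{\<omega>\<in>space M. \<iota> \<omega> = k} = {}" using \<iota>_lt by auto
    then have "prob {\<omega>\<in>space M. \<iota> \<omega> = k} = 0" by (simp only: measure_empty)
    with False show ?thesis by simp
  qed
  \<comment> \<open>All cells have probability \<open>1 / N\<close>, so permuting them preserves the
    law of any function of \<open>\<iota>\<close>.\<close>
  have perm: "p (z \<circ> \<pi>) = p z" if \<pi>: "\<pi> permutes {..<N}" for \<pi> z
  proof -
    have "distr M borel (\<lambda>\<omega>. - z (\<pi> (\<iota> \<omega>))) = distr M borel (\<lambda>\<omega>. - z (\<iota> \<omega>))"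
    proof (rule distr_comp_eqI)
      show "prob {\<omega>\<in>space M. \<pi> (\<iota> \<omega>) = k} = prob {\<omega>\<in>space M. \<iota> \<omega> = k}" for k
      proof -
        have "{\<omega>\<in>space M. \<pi> (\<iota> \<omega>) = k} = {\<omega>\<in>space M. \<iota> \<omega> = inv \<pi> k}"
          using permutes_inverses[OF \<pi>] by force
        moreover have "inv \<pi> k < N \<longleftrightarrow> k < N"
          using permutes_in_image[OF permutes_inv[OF \<pi>], of k] by simp
        ultimately show ?thesis by (simp add: \<iota>_eq)
      qed
      have "\<pi> \<in> measurable (count_space UNIV) (count_space UNIV)" by simp
      then show "(\<lambda>\<omega>. \<pi> (\<iota> \<omega>)) \<in> measurable M (count_space UNIV)" by measurable
    qed simp
    then show ?thesis
      unfolding p_def using rho_law[OF rv[of "z \<circ> \<pi>"] rv[of z]] by simp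
  qed
  have nonpos: "p (\<lambda>j. - of_bool (j = i)) \<le> 0" for i
    using rho_mono[OF rv_const[of 0] rv[of "\<lambda>j. - of_bool (j = i)"]] rho_zero by (simp add: p_def)
  have "\<exists>q. antimono q \<and> (\<forall>i. q i \<ge> 0) \<and> (\<forall>z. (\<Sum>i<N. q i * z i) \<le> p z) \<and>
      p (\<lambda>i. h * (\<Sum>j<m. of_bool (i < a j))) = h * (\<Sum>j<m. \<Sum>i<a j. q i)"
    by (rule sublinear_supporting_sorted[OF sub cong perm nonpos aN h])
  then obtain q where q': "antimono q \<and> (\<forall>i. q i \<ge> 0) \<and> (\<forall>z. (\<Sum>i<N. q i * z i) \<le> p z) \<and>
      p (\<lambda>i. h * (\<Sum>j<m. of_bool (i < a j))) = h * (\<Sum>j<m. \<Sum>i<a j. q i)" ..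
  then have q: "antimono q" "\<And>i. q i \<ge> 0" "\<And>z. (\<Sum>i<N. q i * z i) \<le> p z"
    "p (\<lambda>i. h * (\<Sum>j<m. of_bool (i < a j))) = h * (\<Sum>j<m. \<Sum>i<a j. q i)"
    by (elim conjE, simp)+
  have p_level: "p (\<lambda>i. h' * (\<Sum>j<n. of_bool (i < c j))) = \<rho> (level n h' (\<lambda>j. E (c j)))" for c n h'
    unfolding p_def
  proof (rule rho_cong)
    show "(\<lambda>\<omega>. - (h' * (\<Sum>j<n. of_bool (\<iota> \<omega> < c j)))) \<in> \<X>"
      by (rule rv[of "\<lambda>i. h' * (\<Sum>j<n. of_bool (i < c j))"])
    show "level n h' (\<lambda>j. E (c j)) \<in> \<X>" using E by (intro rv_level)
    show "- (h' * (\<Sum>j<n. of_bool (\<iota> \<omega> < c j))) = level n h' (\<lambda>j. E (c j)) \<omega>"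
      if "\<omega> \<in> space M" for \<omega>
      using that by (simp add: level_def E_def)
  qed
  \<comment> \<open>Domination is tested on the indicator of the first \<open>k\<close> cells,
    written as a \<open>level\<close> with a single layer; the union of these cells has probability
    \<open>k / N\<close>.\<close>
  have Q: "(\<Sum>i<k. q i) \<le> g (real k / real N)" if "k \<le> N" for k
  proof -
    have "(\<Sum>i<k. q i) = 1 * (\<Sum>j<1::nat. \<Sum>i<k. q i)"
      by simp
    also have "\<dots> = (\<Sum>i<N. q i * (1 * (\<Sum>j<1::nat. of_bool (i < k))))"
      by (rule sum_layers[symmetric]) (rule that)
    also have "\<dots> \<le> \<rho> (level 1 1 (\<lambda>_. E k))"
      unfolding p_level[symmetric] by (rule q(3))
    also have "level 1 1 (\<lambda>_. E k) = (\<lambda>\<omega>. - of_bool (\<omega> \<in> E k))"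
      by (rule ext) (simp add: level_def lessThan_Suc)
    also have "\<rho> \<dots> = g (real k / real N)"
      using rho_event[OF E[of k]] \<iota>_prob[OF that] by (simp only: E_def)
    finally show ?thesis .
  qed
  have "\<rho> (level m h S) = \<rho> (level m h (\<lambda>j. A (u j)))"
  proof (rule rho_level_eq[OF S])
    show "A (u j) \<in> events" if "j < m" for j by (rule A(1)[OF uT[OF that]])
    show "A (u i) \<subseteq> A (u j)" if "i \<le> j" "j < m" for i j
      using that by (intro A(3) uT u_mono) auto
    show "prob (S j) = prob (A (u j))" if "j < m" for j
      using A(2)[OF uT[OF that]] by (simp add: u_def)
  qed
  \<comment> \<open>Rounding up enlarges the events and therefore increases \<rho>, so this side is
    free of rounding costs. The weights \<open>q\<close> are exact at the enlarged variable.\<close>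
  also have "\<dots> \<le> \<rho> (level m h (\<lambda>j. E (a j)))"
  proof (rule rho_level_mono[OF _ _ _ h])
    show "A (u j) \<in> events" if "j < m" for j by (rule A(1)[OF uT[OF that]])
    show "A (u j) \<subseteq> E (a j)" if "j < m" for j
      unfolding E_def a_def using round[of "u j"] by (intro \<iota>_sub uT that) (simp_all add: u_def)
  qed (rule E)
  also have "\<dots> = h * (\<Sum>j<m. \<Sum>i<a j. q i)"
    using q(4) p_level by simp
  finally have 1: "\<rho> (level m h S) \<le> h * (\<Sum>j<m. \<Sum>i<a j. q i)" .
  have "h * (\<Sum>j<m. \<Sum>i<b j. q i) = (\<Sum>i<N. q i * (h * (\<Sum>j<m. of_bool (i < b j))))"
    using bN by (rule sum_layers[symmetric])
  also have "\<dots> \<le> \<rho> (level m h (\<lambda>j. E (b j)))"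
    unfolding p_level[symmetric] by (rule q(3))
  \<comment> \<open>Here rounding up goes in the unfavourable direction, and each of the
    \<open>m\<close> layers pays \<open>h * g (1 / N)\<close>.\<close>
  also have "\<dots> \<le> \<rho> (level m h (\<lambda>j. A (v j))) + real m * h * g (1 / real N)"
  proof (rule rho_level_diff)
    fix j assume j: "j < m"
    show "A (v j) \<in> events" using A vT j by simp
    show "A (v j) \<subseteq> E (b j)"
      unfolding E_def b_def using round[of "v j"] by (intro \<iota>_sub vT j) (simp_all add: v_def)
    show "prob (E (b j)) - prob (A (v j)) \<le> 1 / real N"
      using \<iota>_prob[OF bN] A(2)[OF vT[OF j]] round(3)[of "v j"] by (simp add: E_def b_def v_def)
  next
    show "1 / real N \<le> 1" using N by simp
  qed (rule E, rule h)
  also have "\<rho> (level m h (\<lambda>j. A (v j))) = \<rho> (level m h S')"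
  proof (rule rho_level_eq[OF _ _ S'])
    show "A (v j) \<in> events" if "j < m" for j by (rule A(1)[OF vT[OF that]])
    show "A (v i) \<subseteq> A (v j)" if "i \<le> j" "j < m" for i j
      using that by (intro A(3) vT v_mono) auto
    show "prob (A (v j)) = prob (S' j)" if "j < m" for j
      using A(2)[OF vT[OF that]] by (simp add: v_def)
  qed
  finally have 2: "h * (\<Sum>j<m. \<Sum>i<b j. q i) \<le> \<rho> (level m h S') + real m * h * g (1 / real N)" .
  have "(\<Sum>j<m. \<Sum>i<a j. q i) - (\<Sum>j<m. \<Sum>i<b j. q i) \<le> (\<Sum>j<m. \<beta> j)"
    unfolding sum_subtractf[symmetric] a_def b_def u_def v_def
    using bound[OF q(1,2) Q] by (intro sum_mono) auto
  then have "h * (\<Sum>j<m. \<Sum>i<a j. q i) - h * (\<Sum>j<m. \<Sum>i<b j. q i) \<le> h * (\<Sum>j<m. \<beta> j)"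
    using h unfolding right_diff_distrib[symmetric] by (rule mult_left_mono)
  with 1 2 show ?thesis by linarith
qed

end

section \<open>Distribution functions, rounding to a grid and the choice of its offset\<close>

lemma (in prob_space) rv_cdf_eq:
  assumes [measurable]: "X \<in> borel_measurable M"
  shows "rv_cdf M X x = prob {\<omega>\<in>space M. X \<omega> \<le> x}"
proof -
  have "X -` {..x} \<inter> space M = {\<omega>\<in>space M. X \<omega> \<le> x}" by auto
  then show ?thesis by (simp add: rv_cdf_def cdf_def measure_distr)
qed

lemma (in prob_space) rv_cdf_props:
  assumes [measurable]: "X \<in> borel_measurable M"
  shows "0 \<le> rv_cdf M X x" "rv_cdf M X x \<le> 1" "mono (rv_cdf M X)"
  by (auto simp: rv_cdf_eq mono_def intro!: finite_measure_mono)

text \<open>Inside the grid the expression rounds \<open>y\<close> up to the next grid point, with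
  error at most \<open>h\<close>. Outside it clamps \<open>y\<close> to an end of the grid; as the
  grid covers \<open>[- k, k]\<close>, the error is at most the excess of \<open>y\<close> beyond
  that interval.\<close>

lemma grid_sum_approx:
  fixes y x0 h k :: real
  assumes h: "h > 0" and lo: "x0 \<le> - k" and hi: "k \<le> x0 + h * real m"
  shows "\<bar>y - (x0 + h * real m - h * (\<Sum>j<m. of_bool (y \<le> x0 + h * real j)))\<bar>
    \<le> h + (max (y - k) 0 + max (- y - k) 0)"
proof -
  define t where "t = (y - x0) / h"
  define i where "i = nat \<lceil>t\<rceil>"
  have y: "y = x0 + h * t" using h by (simp add: t_def)
  have iff: "y \<le> x0 + h * real j \<longleftrightarrow> i \<le> j" for j
  proof -
    have "y \<le> x0 + h * real j \<longleftrightarrow> t \<le> real j" using h by (simp add: y)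
    also have "\<dots> \<longleftrightarrow> i \<le> j" unfolding i_def by linarith
    finally show ?thesis .
  qed
  have "{j. j < m \<and> i \<le> j} = {i..<m}" by auto
  then have "(\<Sum>j<m. of_bool (i \<le> j)) = real (card {i..<m})"
    by (simp add: of_bool_def sum.If_cases Int_def)
  then have sum: "(\<Sum>j<m. of_bool (y \<le> x0 + h * real j)) = real (m - i)" by (simp add: iff)
  consider "t \<le> 0" | "0 < t" "i \<le> m" | "m < i" by linarith
  then show ?thesis
  proof cases
    case 1
    then have "i = 0" by (simp add: i_def)
    moreover have "y \<le> x0" using 1 h by (simp add: y mult_nonneg_nonpos)
    ultimately show ?thesis using lo h unfolding sum by simp
  next
    case 2
    then have "t \<le> real i" "real i \<le> t + 1" unfolding i_def by linarith+
    then have "h * t \<le> h * real i" "h * real i \<le> h * (t + 1)" using h by simp_all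
    moreover have "x0 + h * real m - h * real (m - i) = x0 + h * real i"
      using 2 by (simp add: of_nat_diff algebra_simps)
    ultimately have "\<bar>y - (x0 + h * real m - h * real (m - i))\<bar> \<le> h"
      using y by (simp add: algebra_simps abs_le_iff)
    then show ?thesis unfolding sum by linarith
  next
    case 3
    then have "real m < t" unfolding i_def by linarith
    then have "x0 + h * real m \<le> y" using h by (simp add: y)
    with 3 hi h show ?thesis unfolding sum by simp
  qed
qed

text \<open>Integrated over \<open>s\<close> in \<open>[0, h)\<close>, the shifted sums exhaust
  disjoint intervals and give at most \<open>h\<close> times the integral of \<open>f\<close>; some
  offset is therefore no worse than average up to \<open>e\<close>. On a fixed grid the sum of a
  merely measurable \<open>f\<close> could be arbitrarily large.\<close>

lemma offset_sum_le_nn_integral: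
  fixes f :: "real \<Rightarrow> ennreal"
  assumes f[measurable]: "f \<in> borel_measurable borel" and I: "(\<integral>\<^sup>+x. f x \<partial>lborel) < \<infinity>"
    and h: "h > 0" and e: "e > 0"
  shows "\<exists>s\<in>{0..<h}. ennreal h * (\<Sum>j<m. f (c + s + h * real j)) \<le> (\<integral>\<^sup>+x. f x \<partial>lborel) + ennreal e"
proof (rule ccontr)
  define I where "I = (\<integral>\<^sup>+x. f x \<partial>lborel)"
  define J where "J j = {c + h * real j..<c + h * real j + h}" for j :: nat
  assume "\<not> ?thesis"
  then have gt: "I + ennreal e \<le> ennreal h * (\<Sum>j<m. f (c + s + h * real j))" if "s \<in> {0..<h}" for s
    using that by (auto simp: I_def not_le intro: less_imp_le)
  have disj: "disjoint_family_on J {..<m}"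
    unfolding disjoint_family_on_def
  proof safe
    fix i j :: nat and x assume ij: "i \<noteq> j" and x: "x \<in> J i" "x \<in> J j"
    have *: "\<not> i < j" if "x \<in> J i" "x \<in> J j" for i j
    proof
      assume "i < j"
      then have "h * (real i + 1) \<le> h * real j" using h by (intro mult_left_mono) auto
      with that show False by (auto simp: J_def algebra_simps)
    qed
    from *[of i j] *[of j i] ij x show "x \<in> {}" by auto
  qed
  have shift: "(\<integral>\<^sup>+s. f (c + s + h * real j) * indicator {0..<h} s \<partial>lborel) = emeasure (density lborel f) (J j)" for j
  proof -
    have "emeasure (density lborel f) (J j) = (\<integral>\<^sup>+x. f x * indicator (J j) x \<partial>lborel)"
      by (subst emeasure_density) (auto simp: J_def)
    also have "\<dots> = (\<integral>\<^sup>+s. f (c + h * real j + 1 * s) * indicator (J j) (c + h * real j + 1 * s) \<partial>lborel)"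
      by (subst nn_integral_real_affine[where c = 1 and t = "c + h * real j"]) (auto simp: J_def)
    also have "\<dots> = (\<integral>\<^sup>+s. f (c + s + h * real j) * indicator {0..<h} s \<partial>lborel)"
      by (intro nn_integral_cong) (auto simp: J_def indicator_def algebra_simps)
    finally show ?thesis ..
  qed
  have "(I + ennreal e) * ennreal h = (\<integral>\<^sup>+s. (I + ennreal e) * indicator {0..<h} s \<partial>lborel)"
    using h by (subst nn_integral_cmult_indicator) auto
  also have "\<dots> \<le> (\<integral>\<^sup>+s. ennreal h * (\<Sum>j<m. f (c + s + h * real j) * indicator {0..<h} s) \<partial>lborel)"
    using gt by (intro nn_integral_mono) (auto simp: indicator_def)
  also have "\<dots> = ennreal h * (\<Sum>j<m. emeasure (density lborel f) (J j))"
    by (subst nn_integral_cmult, measurable, subst nn_integral_sum, measurable) (simp add: shift)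
  also have "(\<Sum>j<m. emeasure (density lborel f) (J j)) = emeasure (density lborel f) (\<Union>j<m. J j)"
    by (rule sum_emeasure[OF _ disj]) (auto simp: J_def)
  also have "\<dots> \<le> emeasure (density lborel f) (space (density lborel f))"
    by (rule emeasure_space)
  also have "\<dots> = I"
    by (simp add: emeasure_density I_def)
  finally have "(I + ennreal e) * ennreal h \<le> ennreal h * I"
    by (simp add: mult_left_mono)
  moreover obtain r where r: "I = ennreal r" "r \<ge> 0"
    using I unfolding I_def[symmetric] by (cases I) auto
  ultimately have "(r + e) * h \<le> h * r"
    using h e by (simp add: ennreal_plus[symmetric] ennreal_mult[symmetric] del: ennreal_plus)
  then show False using mult_pos_pos[OF e h] by (simp add: algebra_simps)
qed

section \<open>Comparison of \<rho> at two variables: finer cells, then a finer grid\<close>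

context coherent_risk
begin

text \<open>As \<open>N\<close> grows the rounding errors disappear and only the concavity estimate remains.\<close>

lemma rho_level_abs_diff:
  assumes S: "\<And>j. j < m \<Longrightarrow> S j \<in> events" "\<And>i j. i \<le> j \<Longrightarrow> j < m \<Longrightarrow> S i \<subseteq> S j"
    and S': "\<And>j. j < m \<Longrightarrow> S' j \<in> events" "\<And>i j. i \<le> j \<Longrightarrow> j < m \<Longrightarrow> S' i \<subseteq> S' j"
    and h: "h \<ge> 0" and g0: "(g \<longlongrightarrow> 0) (at_right 0)" and \<gamma>: "0 < \<gamma>" "\<gamma> < 1"
    and pos: "\<And>j. j < m \<Longrightarrow> prob (S j) \<noteq> prob (S' j) \<Longrightarrow> 0 < prob (S j)"
  shows "\<bar>\<rho> (level m h S) - \<rho> (level m h S')\<bar> \<le> h * (\<Sum>j<m. if prob (S j) = prob (S' j) then 0 else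
    \<bar>prob (S j) - prob (S' j)\<bar> / (1 - \<gamma>) * (g (\<gamma> * prob (S j)) / (\<gamma> * prob (S j))))"
proof -
  define u where "u j = prob (S j)" for j
  define v where "v j = prob (S' j)" for j
  \<comment> \<open>The slope bound after rounding: the gap between two levels grows by at most
    \<open>1 / N\<close>, and the slope is measured at an index of at least
    \<open>N * (\<gamma> * u j - 1 / N)\<close>. Equal levels are split off because
    \<open>u j\<close> may then be 0.\<close>
  define \<beta> where "\<beta> N j = (if u j = v j then 0 else
    (\<bar>u j - v j\<bar> + 1 / real N) / (1 - \<gamma>) * (g (\<gamma> * u j) / (\<gamma> * u j - 1 / real N)))" for N :: nat and j
  define R where "R N = h * (\<Sum>j<m. \<beta> N j) + real m * h * g (1 / real N)" for N :: nat
  have inv0: "(\<lambda>N. 1 / real N) \<longlonglongrightarrow> 0" by (rule lim_1_over_n)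
  have gam: "0 < \<gamma> * u j" if "j < m" "u j \<noteq> v j" for j
    using pos[OF that(1)] that(2) \<gamma> by (simp add: u_def v_def)
  have "(\<lambda>N. g (1 / real N)) \<longlonglongrightarrow> 0"
  proof (rule filterlim_compose[OF g0])
    show "filterlim (\<lambda>N. 1 / real N) (at_right 0) sequentially"
      using inv0 by (auto simp: filterlim_at intro!: eventually_sequentiallyI[of 1])
  qed
  moreover have "(\<lambda>N. \<beta> N j) \<longlonglongrightarrow> (if u j = v j then 0 else
      (\<bar>u j - v j\<bar> + 0) / (1 - \<gamma>) * (g (\<gamma> * u j) / (\<gamma> * u j - 0)))" if "j < m" for j
  proof (cases "u j = v j")
    case False
    have "(\<lambda>N. (\<bar>u j - v j\<bar> + 1 / real N) / (1 - \<gamma>) * (g (\<gamma> * u j) / (\<gamma> * u j - 1 / real N)))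
        \<longlonglongrightarrow> (\<bar>u j - v j\<bar> + 0) / (1 - \<gamma>) * (g (\<gamma> * u j) / (\<gamma> * u j - 0))"
      using gam[OF that False] \<gamma>
      by (intro tendsto_mult tendsto_divide tendsto_add tendsto_diff tendsto_const inv0) auto
    with False show ?thesis by (simp add: \<beta>_def)
  qed (simp add: \<beta>_def)
  ultimately have "R \<longlonglongrightarrow> h * (\<Sum>j<m. if u j = v j then 0 else
      (\<bar>u j - v j\<bar> + 0) / (1 - \<gamma>) * (g (\<gamma> * u j) / (\<gamma> * u j - 0))) + real m * h * 0"
    unfolding R_def[abs_def] by (intro tendsto_add tendsto_mult tendsto_const tendsto_sum) auto
  then have lim: "R \<longlonglongrightarrow> h * (\<Sum>j<m. if u j = v j then 0 else
      \<bar>u j - v j\<bar> / (1 - \<gamma>) * (g (\<gamma> * u j) / (\<gamma> * u j)))"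
    by (simp cong: if_cong)
  have "\<forall>\<^sub>F N in sequentially. \<forall>j\<in>{j. j < m \<and> u j \<noteq> v j}. 1 / real N < \<gamma> * u j"
  proof (rule eventually_ball_finite)
    show "\<forall>j\<in>{j. j < m \<and> u j \<noteq> v j}. \<forall>\<^sub>F N in sequentially. 1 / real N < \<gamma> * u j"
      using order_tendstoD(2)[OF inv0 gam] by blast
  qed simp
  then have bound: "\<forall>\<^sub>F N in sequentially. \<bar>\<rho> (level m h S) - \<rho> (level m h S')\<bar> \<le> R N"
    using eventually_gt_at_top[of 0]
  proof eventually_elim
    case (elim N)
    have key: "\<bar>(\<Sum>i<nat \<lceil>real N * u j\<rceil>. q i) - (\<Sum>i<nat \<lceil>real N * v j\<rceil>. q i)\<bar> \<le> \<beta> N j"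
      if q: "antimono q" "\<And>i. q i \<ge> 0" "\<And>k. k \<le> N \<Longrightarrow> (\<Sum>i<k. q i) \<le> g (real k / real N)"
        and j: "j < m" for q j
    proof (cases "u j = v j")
      case False
      define a where "a = nat \<lceil>real N * u j\<rceil>"
      define b where "b = nat \<lceil>real N * v j\<rceil>"
      \<comment> \<open>The largest integer not above \<open>N * \<gamma> * u j\<close>. It is at
        least 1 for the chosen \<open>N\<close>, so the mean of the first \<open>l\<close> weights
        makes sense.\<close>
      define l where "l = nat \<lfloor>\<gamma> * (real N * u j)\<rfloor>"
      have N: "real N > 0" using elim by simp
      have uv: "0 \<le> u j" "u j \<le> 1" "0 \<le> v j" by (auto simp: u_def v_def)
      have gt1: "1 < \<gamma> * (real N * u j)"
        using elim(1) False j N by (auto simp: field_simps)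
      then have l: "1 \<le> l" "real l \<le> \<gamma> * (real N * u j)" "\<gamma> * (real N * u j) - 1 \<le> real l"
        unfolding l_def by linarith+
      have "real N * u j \<le> real a" unfolding a_def by linarith
      then have "\<gamma> * (real N * u j) \<le> \<gamma> * real a" using \<gamma> by (intro mult_left_mono) auto
      with l have la: "real l \<le> \<gamma> * real a" by simp
      have "\<bar>real a - real b\<bar> \<le> \<bar>real N * u j - real N * v j\<bar> + 1"
      proof -
        have nn: "0 \<le> real N * u j" "0 \<le> real N * v j" using uv by simp_all
        then have "real N * u j \<le> real a" "real a \<le> real N * u j + 1"
          "real N * v j \<le> real b" "real b \<le> real N * v j + 1"
          unfolding a_def b_def by linarith+
        then show ?thesis by linarith
      qed
      also have "\<bar>real N * u j - real N * v j\<bar> = real N * \<bar>u j - v j\<bar>"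
        by (simp add: right_diff_distrib[symmetric] abs_mult)
      finally have ab: "\<bar>real a - real b\<bar> \<le> real N * (\<bar>u j - v j\<bar> + 1 / real N)"
        using N by (simp add: algebra_simps)
      have lN: "real l / real N \<le> \<gamma> * u j"
        using l(2) N by (simp add: field_simps)
      have gu1: "\<gamma> * u j \<le> 1" using uv \<gamma> by (intro mult_le_one) auto
      have "real l / real N \<le> 1" using lN gu1 by linarith
      then have "l \<le> N" using N by simp
      then have "(\<Sum>i<l. q i) \<le> g (real l / real N)" by (rule q(3))
      also have "\<dots> \<le> g (\<gamma> * u j)" using lN gu1 by (intro g_mono) auto
      finally have Ql: "(\<Sum>i<l. q i) \<le> g (\<gamma> * u j)" .
      have gpos: "0 \<le> g (\<gamma> * u j)" using gu1 uv \<gamma> by (intro g_nonneg) auto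
      have Nl: "0 < real N * (\<gamma> * u j - 1 / real N)" "real N * (\<gamma> * u j - 1 / real N) \<le> real l"
        using gt1 l(3) N by (simp_all add: algebra_simps)
      have "\<bar>(\<Sum>i<a. q i) - (\<Sum>i<b. q i)\<bar> \<le> \<bar>real a - real b\<bar> / (1 - \<gamma>) * ((\<Sum>i<l. q i) / real l)"
        by (rule antimono_partial_sums_diff[OF q(1,2) \<gamma> l(1) la])
      also have "\<dots> \<le> (real N * (\<bar>u j - v j\<bar> + 1 / real N)) / (1 - \<gamma>) *
          (g (\<gamma> * u j) / (real N * (\<gamma> * u j - 1 / real N)))"
        using ab Ql Nl gpos \<gamma> q(2) l(1)
        by (intro mult_mono divide_right_mono frac_le divide_nonneg_nonneg sum_nonneg) auto
      also have "\<dots> = \<beta> N j"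
        using False N by (simp add: \<beta>_def)
      finally show ?thesis by (simp add: a_def b_def)
    qed (simp add: \<beta>_def)
    have "\<rho> (level m h S) - \<rho> (level m h S') \<le> R N"
      unfolding R_def
    proof (intro rho_level_rounded S S' h elim(2))
      fix q and j assume "antimono q" "\<And>i. q i \<ge> 0"
        "\<And>k. k \<le> N \<Longrightarrow> (\<Sum>i<k. q i) \<le> g (real k / real N)" "j < m"
      from key[OF this] show "(\<Sum>i<nat \<lceil>real N * prob (S j)\<rceil>. q i) -
          (\<Sum>i<nat \<lceil>real N * prob (S' j)\<rceil>. q i) \<le> \<beta> N j"
        by (simp add: u_def v_def abs_le_iff)
    qed
    \<comment> \<open>With the roles exchanged other supporting weights arise, but
      \<open>key\<close> holds for all admissible weights and bounds an absolute value, so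
      \<open>u j\<close> stays in the denominator.\<close>
    moreover have "\<rho> (level m h S') - \<rho> (level m h S) \<le> R N"
      unfolding R_def
    proof (intro rho_level_rounded S S' h elim(2))
      fix q and j assume "antimono q" "\<And>i. q i \<ge> 0"
        "\<And>k. k \<le> N \<Longrightarrow> (\<Sum>i<k. q i) \<le> g (real k / real N)" "j < m"
      from key[OF this] show "(\<Sum>i<nat \<lceil>real N * prob (S' j)\<rceil>. q i) -
          (\<Sum>i<nat \<lceil>real N * prob (S j)\<rceil>. q i) \<le> \<beta> N j"
        by (simp add: u_def v_def abs_le_iff)
    qed
    ultimately show ?case by simp
  qed
  from tendsto_lowerbound[OF lim bound sequentially_bot] show ?thesis
    unfolding u_def v_def .
qed

lemma rv_max: "stonean \<X> \<Longrightarrow> X \<in> \<X> \<Longrightarrow> Y \<in> \<X> \<Longrightarrow> (\<lambda>\<omega>. max (X \<omega>) (Y \<omega>)) \<in> \<X>"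
  unfolding stonean_def by blast

text \<open>The positive part of \<open>X\<close> exceeds \<open>k \<ge> 0\<close> by the same
  amount as \<open>X\<close> itself, which extends the truncation property from nonnegative
  variables to all.\<close>

lemma rho_tail_tendsto:
  assumes stonean: "stonean \<X>" and X: "X \<in> \<X>"
    and trunc: "\<forall>X\<in>\<X>. (AE \<omega> in M. 0 \<le> X \<omega>) \<longrightarrow>
           (\<lambda>k::nat. \<rho> (\<lambda>\<omega>. - max (X \<omega> - real k) 0)) \<longlonglongrightarrow> 0"
  shows "(\<lambda>k::nat. \<rho> (\<lambda>\<omega>. - max (X \<omega> - real k) 0)) \<longlonglongrightarrow> 0"
proof -
  have pos: "(\<lambda>\<omega>. max (X \<omega>) 0) \<in> \<X>"
    by (rule rv_max[OF stonean X rv_const])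
  have "(\<lambda>k::nat. \<rho> (\<lambda>\<omega>. - max (max (X \<omega>) 0 - real k) 0)) \<longlonglongrightarrow> 0"
    by (rule trunc[rule_format, OF pos]) simp
  moreover have "max (max (X \<omega>) 0 - real k) 0 = max (X \<omega> - real k) 0" for \<omega> and k :: nat
    by (simp add: max_def)
  ultimately show ?thesis by simp
qed

text \<open>The pointwise grid error becomes an error of \<rho> through \<open>rho_diff_le\<close>;
  cash invariance extracts the constants and subadditivity separates the two tails.\<close>

lemma rho_grid_approx:
  fixes k :: real
  assumes stonean: "stonean \<X>" and X: "X \<in> \<X>" and h: "h > 0"
    and lo: "x0 \<le> - k" and hi: "k \<le> x0 + h * real m"
  shows "\<bar>\<rho> X - (\<rho> (level m h (\<lambda>j. {\<omega>\<in>space M. X \<omega> \<le> x0 + h * real j})) - (x0 + h * real m))\<bar>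
    \<le> h + \<rho> (\<lambda>\<omega>. - max (X \<omega> - k) 0) + \<rho> (\<lambda>\<omega>. - max (- X \<omega> - k) 0)"
proof -
  define S where "S j = {\<omega>\<in>space M. X \<omega> \<le> x0 + h * real j}" for j
  have [measurable]: "X \<in> borel_measurable M" using X by (rule rv_measurable)
  have S: "S j \<in> events" for j unfolding S_def by measurable
  have cut: "(\<lambda>\<omega>. max (Y \<omega> - k) 0) \<in> \<X>" if "Y \<in> \<X>" for Y
    using rv_max[OF stonean rv_add[OF that rv_const[of "- k"]] rv_const[of 0]] by simp
  have P: "(\<lambda>\<omega>. max (X \<omega> - k) 0) \<in> \<X>" "(\<lambda>\<omega>. max (- X \<omega> - k) 0) \<in> \<X>"
    using cut[OF X] cut[OF rv_uminus[OF X]] by auto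
  have Z: "(\<lambda>\<omega>. max (X \<omega> - k) 0 + max (- X \<omega> - k) 0) \<in> \<X>"
    by (rule rv_add[OF P])
  have rvS: "level m h S \<in> \<X>" using S by (rule rv_level)
  have "\<bar>\<rho> X - \<rho> (\<lambda>\<omega>. level m h S \<omega> + (x0 + h * real m))\<bar>
      \<le> \<rho> (\<lambda>\<omega>. - (h + (max (X \<omega> - k) 0 + max (- X \<omega> - k) 0)))"
  proof (rule rho_diff_le)
    show "(\<lambda>\<omega>. level m h S \<omega> + (x0 + h * real m)) \<in> \<X>" by (rule rv_add[OF rvS rv_const])
    show "(\<lambda>\<omega>. h + (max (X \<omega> - k) 0 + max (- X \<omega> - k) 0)) \<in> \<X>" by (rule rv_add[OF rv_const Z])
    show "\<bar>X \<omega> - (level m h S \<omega> + (x0 + h * real m))\<bar> \<le> h + (max (X \<omega> - k) 0 + max (- X \<omega> - k) 0)"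
      if "\<omega> \<in> space M" for \<omega>
      using grid_sum_approx[OF h lo hi, of "X \<omega>"] that by (simp add: level_def S_def algebra_simps)
  qed (rule X)
  also have "(\<lambda>\<omega>. - (h + (max (X \<omega> - k) 0 + max (- X \<omega> - k) 0))) =
      (\<lambda>\<omega>. (- max (X \<omega> - k) 0 + - max (- X \<omega> - k) 0) + - h)" by auto
  also have "\<rho> \<dots> = \<rho> (\<lambda>\<omega>. - max (X \<omega> - k) 0 + - max (- X \<omega> - k) 0) - - h"
    by (intro rho_cash rv_add rv_uminus P)
  also have "\<rho> (\<lambda>\<omega>. - max (X \<omega> - k) 0 + - max (- X \<omega> - k) 0) \<le>
      \<rho> (\<lambda>\<omega>. - max (X \<omega> - k) 0) + \<rho> (\<lambda>\<omega>. - max (- X \<omega> - k) 0)"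
    by (intro rho_add rv_uminus P)
  also have "\<rho> (\<lambda>\<omega>. level m h S \<omega> + (x0 + h * real m)) = \<rho> (level m h S) - (x0 + h * real m)"
    by (rule rho_cash[OF rvS])
  finally show ?thesis by (simp add: S_def[abs_def] algebra_simps)
qed

text \<open>Where \<open>f\<close> is infinite the bound claims nothing. The grid chosen for
  \<open>f\<close> has a finite sum and so avoids such points; this allows exceptional points to be
  excluded by setting \<open>f\<close> to infinity on a null set.\<close>

theorem rho_abs_diff_le_nn_integral:
  fixes f :: "real \<Rightarrow> ennreal"
  assumes stonean: "stonean \<X>" and X: "X \<in> \<X>" and Y: "Y \<in> \<X>"
    and trunc: "\<forall>X\<in>\<X>. (AE \<omega> in M. 0 \<le> X \<omega>) \<longrightarrow>
           (\<lambda>k::nat. \<rho> (\<lambda>\<omega>. - max (X \<omega> - real k) 0)) \<longlonglongrightarrow> 0"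
    and g0: "(g \<longlongrightarrow> 0) (at_right 0)" and \<gamma>: "0 < \<gamma>" "\<gamma> < 1"
    and f: "f \<in> borel_measurable borel" "(\<integral>\<^sup>+x. f x \<partial>lborel) < \<infinity>"
    and bound: "\<And>x. rv_cdf M X x \<noteq> rv_cdf M Y x \<Longrightarrow> f x < \<infinity> \<Longrightarrow> 0 < rv_cdf M X x \<and>
      ennreal (\<bar>rv_cdf M X x - rv_cdf M Y x\<bar> * g (\<gamma> * rv_cdf M X x) / rv_cdf M X x) \<le> f x"
  shows "\<bar>\<rho> X - \<rho> Y\<bar> \<le> enn2real (\<integral>\<^sup>+x. f x \<partial>lborel) / (\<gamma> * (1 - \<gamma>))"
proof (rule field_le_epsilon)
  define I where "I = (\<integral>\<^sup>+x. f x \<partial>lborel)"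
  define c where "c = 1 / (\<gamma> * (1 - \<gamma>))"
  have c: "c > 0" using \<gamma> by (simp add: c_def)
  fix e0 :: real assume "e0 > 0"
  \<comment> \<open>For each of \<open>X\<close> and \<open>Y\<close> the grid step and the two
    tails contribute at most \<open>e\<close>, six errors in all; the offset of the grid contributes
    \<open>c * e\<close>.\<close>
  define e where "e = e0 / (6 + c)"
  have e: "e > 0" using \<open>e0 > 0\<close> c by (simp add: e_def)
  have [measurable]: "X \<in> borel_measurable M" "Y \<in> borel_measurable M"
    using X Y by (auto intro: rv_measurable)
  have "\<forall>\<^sub>F k::nat in sequentially. \<rho> (\<lambda>\<omega>. - max (Z \<omega> - real k) 0) < e" if "Z \<in> \<X>" for Z
    by (rule order_tendstoD(2)[OF rho_tail_tendsto[OF stonean that trunc] e])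
  then have "\<forall>\<^sub>F k::nat in sequentially.
      \<rho> (\<lambda>\<omega>. - max (X \<omega> - real k) 0) < e \<and> \<rho> (\<lambda>\<omega>. - max (- X \<omega> - real k) 0) < e \<and>
      \<rho> (\<lambda>\<omega>. - max (Y \<omega> - real k) 0) < e \<and> \<rho> (\<lambda>\<omega>. - max (- Y \<omega> - real k) 0) < e"
    using X Y by (intro eventually_conj) (auto intro: rv_uminus)
  then obtain k :: nat where k:
      "\<rho> (\<lambda>\<omega>. - max (X \<omega> - real k) 0) < e" "\<rho> (\<lambda>\<omega>. - max (- X \<omega> - real k) 0) < e"
      "\<rho> (\<lambda>\<omega>. - max (Y \<omega> - real k) 0) < e" "\<rho> (\<lambda>\<omega>. - max (- Y \<omega> - real k) 0) < e"
    using eventually_happens'[OF sequentially_bot] by blast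
  \<comment> \<open>The grid starts at \<open>- k - e + s\<close> with \<open>0 \<le> s < e\<close>,
    hence at or below \<open>- k\<close>; this \<open>m\<close> makes it reach \<open>k\<close>
    whatever the offset.\<close>
  obtain m :: nat where m: "(2 * real k + e) / e \<le> real m" using real_arch_simple by blast
  obtain s where s: "s \<in> {0..<e}" and
    sum: "ennreal e * (\<Sum>j<m. f ((- real k - e) + s + e * real j)) \<le> I + ennreal e"
    using offset_sum_le_nn_integral[OF f e e, where m = m and c = "- real k - e"] by (auto simp: I_def)
  define x where "x j = - real k - e + s + e * real j" for j :: nat
  have x_mono: "x i \<le> x j" if "i \<le> j" for i j
    unfolding x_def using that e by (simp add: mult_left_mono)
  have lo: "x 0 \<le> - real k" using s by (simp add: x_def)
  have "2 * real k + e \<le> e * real m" using m e by (simp add: field_simps)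
  then have hi: "real k \<le> x 0 + e * real m" using s by (simp add: x_def)
  define S where "S Z j = {\<omega>\<in>space M. Z \<omega> \<le> x j}" for Z :: "'a \<Rightarrow> real" and j
  have cdf: "prob (S Z j) = rv_cdf M Z (x j)" if [measurable]: "Z \<in> borel_measurable M" for Z j
  by (simp add: rv_cdf_eq S_def)
  define F where "F j = rv_cdf M X (x j)" for j
  define G where "G j = rv_cdf M Y (x j)" for j
  have fin: "f (x j) < \<infinity>" if "j < m" for j
  proof -
    have "I + ennreal e < \<infinity>" using f(2) by (simp add: I_def)
    with sum have "ennreal e * (\<Sum>j<m. f (x j)) < \<infinity>" unfolding x_def by (rule le_less_trans)
    then have "(\<Sum>j<m. f (x j)) < \<infinity>"
      using e by (auto simp: ennreal_mult_less_top)
    moreover have "f (x j) \<le> (\<Sum>j<m. f (x j))" using that by (intro member_le_sum) auto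
    ultimately show ?thesis by (rule le_less_trans[rotated])
  qed
  define r where "r j = (if F j = G j then 0 else \<bar>F j - G j\<bar> * g (\<gamma> * F j) / F j)" for j
  have F01: "0 \<le> F j" "F j \<le> 1" for j
    using cdf[of X j] by (auto simp: F_def simp flip: cdf)
  have r_nonneg: "0 \<le> r j" for j
    unfolding r_def using F01[of j] \<gamma> by (auto intro!: divide_nonneg_nonneg mult_nonneg_nonneg g_nonneg mult_le_one)
  have r_le: "ennreal (r j) \<le> f (x j)" if "j < m" for j
    using bound[of "x j"] fin[OF that] by (auto simp: r_def F_def G_def)
  have "ennreal (e * (\<Sum>j<m. r j)) = ennreal e * (\<Sum>j<m. ennreal (r j))"
    using e r_nonneg by (simp add: ennreal_mult sum_nonneg sum_ennreal)
  also have "\<dots> \<le> ennreal e * (\<Sum>j<m. f (x j))"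
    using r_le by (intro mult_left_mono sum_mono) auto
  also have "\<dots> \<le> I + ennreal e" using sum by (simp add: x_def)
  also have "\<dots> = ennreal (enn2real I + e)"
    using f(2) e by (simp add: I_def ennreal_plus)
  finally have r_sum: "e * (\<Sum>j<m. r j) \<le> enn2real I + e"
    using e by (subst (asm) ennreal_le_iff) (auto simp: add_nonneg_nonneg)
  have S: "S Z j \<in> events" "i \<le> j \<Longrightarrow> S Z i \<subseteq> S Z j" if [measurable]: "Z \<in> borel_measurable M" for Z i j
  proof -
    show "S Z j \<in> events" unfolding S_def by measurable
    show "i \<le> j \<Longrightarrow> S Z i \<subseteq> S Z j" using x_mono by (force simp: S_def)
  qed
  have "\<bar>\<rho> (level m e (S X)) - \<rho> (level m e (S Y))\<bar> \<le>
      e * (\<Sum>j<m. if prob (S X j) = prob (S Y j) then 0 else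
        \<bar>prob (S X j) - prob (S Y j)\<bar> / (1 - \<gamma>) * (g (\<gamma> * prob (S X j)) / (\<gamma> * prob (S X j))))"
  proof (rule rho_level_abs_diff[OF S(1) S(2) S(1) S(2) _ g0 \<gamma>])
    show "0 < prob (S X j)" if "j < m" "prob (S X j) \<noteq> prob (S Y j)" for j
      using bound[OF _ fin[OF that(1)]] that(2) by (simp add: cdf)
  qed (use e in auto)
  also have "\<dots> = e * (\<Sum>j<m. c * r j)"
    by (intro arg_cong2[where f = "(*)"] sum.cong) (auto simp: cdf F_def G_def r_def c_def)
  also have "\<dots> = c * (e * (\<Sum>j<m. r j))"
    by (simp add: sum_distrib_left algebra_simps)
  also have "\<dots> \<le> c * (enn2real I + e)"
    using r_sum c by (intro mult_left_mono) auto
  finally have mid: "\<bar>\<rho> (level m e (S X)) - \<rho> (level m e (S Y))\<bar> \<le> c * enn2real I + c * e"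
    by (simp add: algebra_simps)
  have grid: "S Z = (\<lambda>j. {\<omega>\<in>space M. Z \<omega> \<le> x 0 + e * real j})" for Z
    by (auto simp: S_def x_def)
  have "\<bar>\<rho> X - (\<rho> (level m e (S X)) - (x 0 + e * real m))\<bar> \<le> e + e + e"
    using rho_grid_approx[OF stonean X e lo hi] k unfolding grid by linarith
  moreover have "\<bar>\<rho> Y - (\<rho> (level m e (S Y)) - (x 0 + e * real m))\<bar> \<le> e + e + e"
    using rho_grid_approx[OF stonean Y e lo hi] k unfolding grid by linarith
  ultimately have "\<bar>\<rho> X - \<rho> Y\<bar> \<le> c * enn2real I + (6 + c) * e"
    using mid by (simp add: algebra_simps)
  also have "(6 + c) * e = e0" using c by (simp add: e_def)
  finally show "\<bar>\<rho> X - \<rho> Y\<bar> \<le> enn2real (\<integral>\<^sup>+x. f x \<partial>lborel) / (\<gamma> * (1 - \<gamma>)) + e0"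
    by (simp add: c_def I_def)
qed

end

section \<open>Distortion risk measures\<close>

text \<open>Concavity on the chord from the origin, where \<open>g 0 = 0\<close>: the quotient
  \<open>g t / t\<close> is nonincreasing.\<close>

lemma concave_distortion_ratio:
  assumes g: "distortion_function g" "concave_on {0..1} g" and ab: "0 < a" "a \<le> b" "b \<le> 1"
  shows "g b \<le> b * (g a / a)"
proof -
  have "(1 - a / b) * g 0 + (a / b) * g b \<le> g ((1 - a / b) *\<^sub>R 0 + (a / b) *\<^sub>R b)"
    using ab by (intro concave_onD[OF g(2)]) auto
  then have "a / b * g b \<le> g a"
    using g(1) ab by (simp add: distortion_function_def)
  then show ?thesis using ab by (simp add: field_simps)
qed

text \<open>The continuous counterpart of \<open>antimono_partial_sums_diff\<close>. Right of
  \<open>\<gamma> * s\<close> slopes are at most \<open>A\<close>; for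
  \<open>t < \<gamma> * s\<close> the bound \<open>g s \<le> s * A\<close> is combined with a gap of
  at least \<open>(1 - \<gamma>) * s\<close>. The other factor \<open>\<gamma>\<close> in the
  constant is the one in the denominator of \<open>A\<close>.\<close>

lemma concave_distortion_diff:
  assumes g: "distortion_function g" "concave_on {0..1} g" and \<gamma>: "0 < \<gamma>" "\<gamma> < 1"
    and s: "0 < s" "s \<le> 1" and t: "0 \<le> t" "t \<le> 1"
  shows "\<bar>g s - g t\<bar> \<le> \<bar>s - t\<bar> * g (\<gamma> * s) / s / (\<gamma> * (1 - \<gamma>))"
proof -
  have mono: "g x \<le> g y" if "0 \<le> x" "x \<le> y" "y \<le> 1" for x y
    using g(1) that by (auto simp: distortion_function_def monotone_on_def)
  have nonneg: "0 \<le> g x" if "0 \<le> x" "x \<le> 1" for x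
    using g(1) that by (auto simp: distortion_function_def)
  have \<gamma>s: "0 < \<gamma> * s" "\<gamma> * s \<le> s" "\<gamma> * s \<le> 1"
    using \<gamma> s by (auto intro: mult_le_one)
  define A where "A = g (\<gamma> * s) / (\<gamma> * s)"
  have A: "0 \<le> A" using nonneg[of "\<gamma> * s"] \<gamma>s by (simp add: A_def)
  have eq: "\<bar>s - t\<bar> * g (\<gamma> * s) / s / (\<gamma> * (1 - \<gamma>)) = \<bar>s - t\<bar> / (1 - \<gamma>) * A"
    by (simp add: A_def)
  have ratio: "g b \<le> b * A" if "\<gamma> * s \<le> b" "b \<le> 1" for b
    unfolding A_def using concave_distortion_ratio[OF g \<gamma>s(1) that] .
  have incr: "g b - g a \<le> (b - a) * A" if "\<gamma> * s \<le> a" "a \<le> b" "b \<le> 1" for a b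
  proof -
    have a: "0 < a" using that \<gamma>s by linarith
    have "g b - g a \<le> b * (g a / a) - g a"
      using concave_distortion_ratio[OF g a that(2,3)] by simp
    also have "\<dots> = (b - a) * (g a / a)" using a by (simp add: field_simps)
    also have "\<dots> \<le> (b - a) * A"
      using ratio[of a] that a by (intro mult_left_mono) (auto simp: field_simps)
    finally show ?thesis .
  qed
  show ?thesis
  proof (cases "\<gamma> * s \<le> t")
    case True
    have "\<bar>g s - g t\<bar> \<le> \<bar>s - t\<bar> * A"
    proof (cases "s \<le> t")
      case st: True
      then show ?thesis using incr[of s t] \<gamma>s s t mono[of s t] by simp
    next
      case False
      then show ?thesis using incr[of t s] True s t mono[of t s] by simp
    qed
    also have "\<dots> \<le> \<bar>s - t\<bar> / (1 - \<gamma>) * A"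
    proof (intro mult_right_mono A)
      have "\<bar>s - t\<bar> * (1 - \<gamma>) \<le> \<bar>s - t\<bar> * 1" using \<gamma> by (intro mult_left_mono) auto
      then show "\<bar>s - t\<bar> \<le> \<bar>s - t\<bar> / (1 - \<gamma>)" using \<gamma> by (simp add: field_simps)
    qed
    finally show ?thesis unfolding eq .
  next
    case False
    then have "t \<le> s" using \<gamma>s by linarith
    have "\<bar>g s - g t\<bar> \<le> g s"
      using nonneg[of t] mono[of t s] \<open>t \<le> s\<close> s t by simp
    also have "\<dots> \<le> s * A" using ratio[of s] \<gamma>s s by simp
    also have "\<dots> \<le> \<bar>s - t\<bar> / (1 - \<gamma>) * A"
    proof (intro mult_right_mono A)
      have "s * (1 - \<gamma>) \<le> \<bar>s - t\<bar>" using False by (simp add: algebra_simps)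
      then show "s \<le> \<bar>s - t\<bar> / (1 - \<gamma>)" using \<gamma> by (simp add: field_simps)
    qed
    finally show ?thesis unfolding eq .
  qed
qed

lemma (in prob_space) borel_measurable_distortion_cdf:
  assumes g: "mono_on {0..1} g" and X: "X \<in> borel_measurable M" and \<gamma>: "0 \<le> \<gamma>" "\<gamma> \<le> 1"
  shows "(\<lambda>x. g (\<gamma> * rv_cdf M X x) :: real) \<in> borel_measurable borel"
proof (rule borel_measurable_mono, rule monoI)
  fix x y :: real assume "x \<le> y"
  then show "g (\<gamma> * rv_cdf M X x) \<le> g (\<gamma> * rv_cdf M X y)"
    using rv_cdf_props[OF X] \<gamma>
    by (intro monotone_onD[OF g]) (auto intro!: mult_left_mono mult_le_one dest: monoD)
qed

text \<open>The domain condition controls the tail of \<open>\<bar>X\<bar>\<close>. It dominates the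
  lower tail of \<open>X\<close> after a shift; on the positive half-line concavity gives
  \<open>t \<le> g t\<close>, hence \<open>1 - g (F x) \<le> 1 - F x \<le> H x\<close>.\<close>

lemma (in prob_space) distortion_integrable:
  assumes g: "distortion_function g" "concave_on {0..1} g" and X: "X \<in> distortion_domain M g"
  shows "set_integrable lborel {..0} (\<lambda>x. g (rv_cdf M X x))"
    "set_integrable lborel {0..} (\<lambda>x. 1 - g (rv_cdf M X x))"
proof -
  have [measurable]: "X \<in> borel_measurable M" using X by (simp add: distortion_domain_def)
  define F where "F = rv_cdf M X"
  define H where "H z = g (1 - rv_cdf M (\<lambda>\<omega>. \<bar>X \<omega>\<bar>) z)" for z
  have fin: "(\<integral>\<^sup>+x\<in>{0..}. ennreal (H x) \<partial>lborel) < \<infinity>"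
    using X by (simp add: distortion_domain_def H_def)
  have g_mono: "mono_on {0..1} g" using g(1) by (simp add: distortion_function_def)
  have F01: "0 \<le> F x" "F x \<le> 1" "0 \<le> 1 - rv_cdf M (\<lambda>\<omega>. \<bar>X \<omega>\<bar>) x" "1 - rv_cdf M (\<lambda>\<omega>. \<bar>X \<omega>\<bar>) x \<le> 1" for x
    by (simp_all add: F_def rv_cdf_props)
  have g01: "0 \<le> g t" "g t \<le> 1" if "0 \<le> t" "t \<le> 1" for t
    using g(1) that by (auto simp: distortion_function_def)
  have [measurable]: "(\<lambda>x. g (F x)) \<in> borel_measurable borel"
    using borel_measurable_distortion_cdf[OF g_mono, of X 1] by (simp add: F_def)
  have [measurable]: "H \<in> borel_measurable borel"
  proof -
    have "mono (\<lambda>z. - H z)"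
      unfolding H_def using F01 rv_cdf_props(3)[of "\<lambda>\<omega>. \<bar>X \<omega>\<bar>"]
      by (intro monoI le_imp_neg_le monotone_onD[OF g_mono]) (auto dest: monoD)
    from borel_measurable_uminus[OF borel_measurable_mono[OF this]] show ?thesis by simp
  qed
  have tail: "1 - rv_cdf M (\<lambda>\<omega>. \<bar>X \<omega>\<bar>) z = prob {\<omega>\<in>space M. \<bar>X \<omega>\<bar> > z}" for z
  proof -
    have "prob (space M - {\<omega>\<in>space M. \<bar>X \<omega>\<bar> \<le> z}) = 1 - prob {\<omega>\<in>space M. \<bar>X \<omega>\<bar> \<le> z}"
      by (intro prob_compl) measurable
    also have "space M - {\<omega>\<in>space M. \<bar>X \<omega>\<bar> \<le> z} = {\<omega>\<in>space M. \<bar>X \<omega>\<bar> > z}" by auto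
    finally show ?thesis by (simp add: rv_cdf_eq)
  qed
  have "(\<integral>\<^sup>+x. ennreal (norm (indicator {..0} x *\<^sub>R g (F x))) \<partial>lborel)
      \<le> (\<integral>\<^sup>+x. ennreal (H (- 1 + (- 1) * x)) * indicator {- 1..} (- 1 + (- 1) * x) \<partial>lborel)"
  proof (intro nn_integral_mono)
    fix x :: real
    \<comment> \<open>The shift by 1 turns the weak inequality \<open>X \<le> x\<close> into the
      strict one in the tail of \<open>\<bar>X\<bar>\<close>. It adds only the interval
      \<open>[- 1, 0]\<close>, where the integrand is at most 1.\<close>
    have "F x \<le> 1 - rv_cdf M (\<lambda>\<omega>. \<bar>X \<omega>\<bar>) (- 1 - x)"
      unfolding tail F_def rv_cdf_eq[OF \<open>X \<in> borel_measurable M\<close>] by (intro finite_measure_mono) auto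
    then have "g (F x) \<le> H (- 1 - x)"
      unfolding H_def using F01 by (intro monotone_onD[OF g_mono]) auto
    then show "ennreal (norm (indicator {..0} x *\<^sub>R g (F x)))
        \<le> ennreal (H (- 1 + (- 1) * x)) * indicator {- 1..} (- 1 + (- 1) * x)"
      using g01 F01 by (auto simp: indicator_def intro!: ennreal_leI)
  qed
  also have "\<dots> = (\<integral>\<^sup>+z. ennreal (H z) * indicator {- 1..} z \<partial>lborel)"
    by (subst nn_integral_real_affine[where c = "- 1" and t = "- 1" and
      f = "\<lambda>z. ennreal (H z) * indicator {- 1..} z"]) auto
  also have "\<dots> \<le> (\<integral>\<^sup>+z. indicator {- 1..0} z + ennreal (H z) * indicator {0..} z \<partial>lborel)"
    using g01 F01 by (intro nn_integral_mono) (auto simp: indicator_def H_def)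
  also have "\<dots> = (\<integral>\<^sup>+z. indicator {- 1..0::real} z \<partial>lborel) + (\<integral>\<^sup>+z\<in>{0..}. ennreal (H z) \<partial>lborel)"
    by (intro nn_integral_add) auto
  also have "\<dots> < \<infinity>" using fin by simp
  finally show "set_integrable lborel {..0} (\<lambda>x. g (rv_cdf M X x))"
    unfolding set_integrable_def F_def[symmetric] by (intro integrableI_bounded) auto
  have "(\<integral>\<^sup>+x. ennreal (norm (indicator {0..} x *\<^sub>R (1 - g (F x)))) \<partial>lborel)
      \<le> (\<integral>\<^sup>+x\<in>{0..}. ennreal (H x) \<partial>lborel)"
  proof (intro nn_integral_mono)
    fix x :: real
    have g_ge: "t \<le> g t" if "0 \<le> t" "t \<le> 1" for t
    proof (cases "t = 0")
      case False
      with that have "g 1 \<le> 1 * (g t / t)" by (intro concave_distortion_ratio[OF g]) auto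
      then show ?thesis using g(1) that False by (simp add: distortion_function_def field_simps)
    qed (use g01 in simp)
    have "rv_cdf M (\<lambda>\<omega>. \<bar>X \<omega>\<bar>) x \<le> F x"
      unfolding F_def by (simp add: rv_cdf_eq) (intro finite_measure_mono, auto)
    then have "1 - g (F x) \<le> H x"
      unfolding H_def using g_ge[of "F x"] g_ge[of "1 - rv_cdf M (\<lambda>\<omega>. \<bar>X \<omega>\<bar>) x"] F01[of x] by simp
    then show "ennreal (norm (indicator {0..} x *\<^sub>R (1 - g (F x)))) \<le> ennreal (H x) * indicator {0..} x"
      using g01[OF F01(1,2), of x] by (auto simp: indicator_def intro!: ennreal_leI)
  qed
  also have "\<dots> < \<infinity>" by (rule fin)
  finally show "set_integrable lborel {0..} (\<lambda>x. 1 - g (rv_cdf M X x))"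
    unfolding set_integrable_def F_def[symmetric] by (intro integrableI_bounded) auto
qed

text \<open>The constant 1 on the positive half-line cancels in the difference, so both half-lines
  contribute \<open>D\<close>; their common point 0 is counted twice but has measure 0.\<close>

lemma (in prob_space) distortion_risk_diff:
  assumes g: "distortion_function g" "concave_on {0..1} g"
    and X: "X \<in> distortion_domain M g" and Y: "Y \<in> distortion_domain M g"
  shows "ennreal \<bar>distortion_risk M g X - distortion_risk M g Y\<bar>
    \<le> (\<integral>\<^sup>+x. ennreal \<bar>g (rv_cdf M X x) - g (rv_cdf M Y x)\<bar> \<partial>lborel)"
proof -
  define D where "D x = g (rv_cdf M X x) - g (rv_cdf M Y x)" for x
  note X_int = distortion_integrable[OF g X] and Y_int = distortion_integrable[OF g Y]
  have D_int: "set_integrable lborel {..0} D" "set_integrable lborel {0..} D"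
    using set_integral_diff(1)[OF X_int(1) Y_int(1)] set_integral_diff(1)[OF Y_int(2) X_int(2)]
    by (simp_all add: D_def[abs_def])
  have "distortion_risk M g X - distortion_risk M g Y = (LINT x:{..0}|lborel. D x) + (LINT x:{0..}|lborel. D x)"
    using set_integral_diff(2)[OF X_int(1) Y_int(1)] set_integral_diff(2)[OF Y_int(2) X_int(2)]
    by (simp add: D_def[abs_def] distortion_risk_def)
  then have "ennreal \<bar>distortion_risk M g X - distortion_risk M g Y\<bar>
      \<le> ennreal (norm (LINT x:{..0}|lborel. D x)) + ennreal (norm (LINT x:{0..}|lborel. D x))"
    by (simp add: ennreal_plus[symmetric] del: ennreal_plus)
  also have "\<dots> \<le> (\<integral>\<^sup>+x. ennreal (norm (indicator {..0} x *\<^sub>R D x)) \<partial>lborel) +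
      (\<integral>\<^sup>+x. ennreal (norm (indicator {0..} x *\<^sub>R D x)) \<partial>lborel)"
    using D_int unfolding set_integrable_def set_lebesgue_integral_def
    by (intro add_mono integral_norm_bound_ennreal)
  also have "\<dots> = (\<integral>\<^sup>+x. ennreal (norm (indicator {..0} x *\<^sub>R D x)) +
      ennreal (norm (indicator {0..} x *\<^sub>R D x)) \<partial>lborel)"
    using D_int unfolding set_integrable_def
    by (intro nn_integral_add[symmetric] measurable_compose[OF _ measurable_ennreal]
      borel_measurable_integrable integrable_norm)
  also have "\<dots> = (\<integral>\<^sup>+x. ennreal \<bar>D x\<bar> \<partial>lborel)"
  proof (rule nn_integral_cong_AE)
    show "AE x in lborel. ennreal (norm (indicator {..0} x *\<^sub>R D x)) +
        ennreal (norm (indicator {0..} x *\<^sub>R D x)) = ennreal \<bar>D x\<bar>"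
      using AE_lborel_singleton[of 0] by eventually_elim (auto simp: indicator_def)
  qed
  finally show ?thesis by (simp add: D_def)
qed

section \<open>Weighted perturbations of a distribution function\<close>

text \<open>Membership confines \<open>v\<close> to the closed support interval, whereas the
  integral condition lives on the open one; the two ends are therefore kept as separate
  alternatives.\<close>

lemma weighted_cadlag_suppD:
  assumes v: "v \<in> weighted_cadlag_supp \<phi> F" and \<phi>: "weight_function \<phi>"
  shows "\<bar>v x\<bar> \<le> weighted_norm \<phi> v / \<phi> x" "0 \<le> weighted_norm \<phi> v"
    and "v x \<noteq> 0 \<Longrightarrow> x \<in> supp_interior F \<or> ereal x = right_inv F 0 \<or> ereal x = left_inv F 1"
proof -
  have pos: "1 \<le> \<phi> x" for x using \<phi> by (simp add: weight_function_def)
  have "bdd_above (range (\<lambda>x. \<bar>v x * \<phi> x\<bar>))"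
    using v by (simp add: weighted_cadlag_supp_def weighted_cadlag_def)
  then have le: "\<bar>v x * \<phi> x\<bar> \<le> weighted_norm \<phi> v" for x
    unfolding weighted_norm_def by (intro cSUP_upper) auto
  show "\<bar>v x\<bar> \<le> weighted_norm \<phi> v / \<phi> x"
    using le[of x] pos[of x] by (simp add: abs_mult field_simps)
  show "0 \<le> weighted_norm \<phi> v"
    using le[of x] by linarith
  show "x \<in> supp_interior F \<or> ereal x = right_inv F 0 \<or> ereal x = left_inv F 1" if "v x \<noteq> 0"
    using v that by (auto simp: weighted_cadlag_supp_def supp_interior_def less_le)
qed

lemma supp_interior_pos:
  assumes "mono F" "x \<in> supp_interior F"
  shows "0 < F x"
proof -
  have "Inf {ereal y | y. F y > 0} < ereal x"
    using assms(2) by (simp add: supp_interior_def right_inv_def)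
  then obtain y where "F y > 0" "y < x" by (auto simp: Inf_less_iff)
  then show ?thesis using monoD[OF assms(1), of y x] by simp
qed

lemma borel_supp_interior[measurable]: "supp_interior F \<in> sets borel"
  unfolding supp_interior_def by measurable

lemma AE_not_ereal_eq: "AE x in lborel. ereal x \<noteq> c"
proof -
  have "AE x in lborel. x \<noteq> real_of_ereal c" by (rule AE_lborel_singleton)
  then show ?thesis by eventually_elim auto
qed

lemma borel_measurable_weight_function: "weight_function \<phi> \<Longrightarrow> \<phi> \<in> borel_measurable borel"
  by (auto simp: weight_function_def intro: borel_measurable_continuous_onI)

lemma (in coherent_risk) coherent_weighted_lipschitz:
  assumes stonean: "stonean \<X>"
    and trunc: "\<forall>X\<in>\<X>. (AE \<omega> in M. 0 \<le> X \<omega>) \<longrightarrow>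
           (\<lambda>k::nat. \<rho> (\<lambda>\<omega>. - max (X \<omega> - real k) 0)) \<longlonglongrightarrow> 0"
    and g0: "(g \<longlongrightarrow> 0) (at_right 0)" and \<gamma>: "0 < \<gamma>" "\<gamma> < 1"
    and \<phi>: "weight_function \<phi>" and X: "X \<in> \<X>" and Y: "Y \<in> \<X>"
    and int: "(\<integral>\<^sup>+x\<in>supp_interior (rv_cdf M X).
        ennreal (g (\<gamma> * rv_cdf M X x) / (rv_cdf M X x * \<phi> x)) \<partial>lborel) = I" "I < \<infinity>"
    and v: "(\<lambda>x. rv_cdf M Y x - rv_cdf M X x) \<in> weighted_cadlag_supp \<phi> (rv_cdf M X)"
  shows "\<bar>\<rho> Y - \<rho> X\<bar> \<le> weighted_norm \<phi> (\<lambda>x. rv_cdf M Y x - rv_cdf M X x) * (enn2real I / (\<gamma> * (1 - \<gamma>)))"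
proof -
  define F where "F = rv_cdf M X"
  define \<delta> where "\<delta> = weighted_norm \<phi> (\<lambda>x. rv_cdf M Y x - F x)"
  define K where "K x = g (\<gamma> * F x) / (F x * \<phi> x)" for x
  define E where "E = {x. ereal x = right_inv F 0 \<or> ereal x = left_inv F 1}"
  \<comment> \<open>A perturbation may be nonzero at the ends of the support, which the integral
    condition does not cover. They form a null set, and the value infinity there keeps the grid away
    from them.\<close>
  define f where "f x = (if x \<in> E then \<infinity> else ennreal \<delta> * (ennreal (K x) * indicator (supp_interior F) x))" for x
  have Xm: "X \<in> borel_measurable M" using X by (rule rv_measurable)
  note F = rv_cdf_props[OF Xm, folded F_def]
  have "mono_on {0..1} g" by (intro monotone_onI g_mono) auto
  then have [measurable]: "(\<lambda>x. g (\<gamma> * F x)) \<in> borel_measurable borel"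
    unfolding F_def using Xm \<gamma> by (intro borel_measurable_distortion_cdf) auto
  have [measurable]: "F \<in> borel_measurable borel" "\<phi> \<in> borel_measurable borel"
    using F(3) \<phi> by (auto intro: borel_measurable_mono borel_measurable_weight_function)
  have [measurable]: "E \<in> sets borel" unfolding E_def by measurable
  have K[measurable]: "K \<in> borel_measurable borel" unfolding K_def by measurable
  note vD = weighted_cadlag_suppD[OF v \<phi>, folded F_def, folded \<delta>_def]
  have f_meas: "f \<in> borel_measurable borel" unfolding f_def by measurable
  have "(\<integral>\<^sup>+x. f x \<partial>lborel) = (\<integral>\<^sup>+x. ennreal \<delta> * (ennreal (K x) * indicator (supp_interior F) x) \<partial>lborel)"
  proof (rule nn_integral_cong_AE)
    show "AE x in lborel. f x = ennreal \<delta> * (ennreal (K x) * indicator (supp_interior F) x)"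
      using AE_not_ereal_eq[of "right_inv F 0"] AE_not_ereal_eq[of "left_inv F 1"]
      by eventually_elim (simp add: f_def E_def)
  qed
  also have "\<dots> = ennreal \<delta> * I"
    unfolding int(1)[symmetric] K_def F_def[symmetric]
    by (rule nn_integral_cmult) (use K in \<open>simp add: K_def\<close>)
  finally have f_int: "(\<integral>\<^sup>+x. f x \<partial>lborel) = ennreal \<delta> * I" .
  have "\<bar>\<rho> X - \<rho> Y\<bar> \<le> enn2real (\<integral>\<^sup>+x. f x \<partial>lborel) / (\<gamma> * (1 - \<gamma>))"
  proof (rule rho_abs_diff_le_nn_integral[OF stonean X Y trunc g0 \<gamma> f_meas])
    show "(\<integral>\<^sup>+x. f x \<partial>lborel) < \<infinity>"
      using int(2) by (simp add: f_int ennreal_mult_less_top)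
  next
    fix x assume ne: "rv_cdf M X x \<noteq> rv_cdf M Y x" and "f x < \<infinity>"
    then have "x \<notin> E" by (auto simp: f_def)
    with ne vD(3)[of x] have x: "x \<in> supp_interior F" by (auto simp: E_def F_def)
    then have pos: "0 < F x" by (rule supp_interior_pos[OF F(3)])
    have g_nn: "0 \<le> g (\<gamma> * F x)"
      using F(1,2) \<gamma> by (intro g_nonneg mult_le_one) auto
    have "\<bar>F x - rv_cdf M Y x\<bar> * g (\<gamma> * F x) / F x \<le> \<delta> / \<phi> x * g (\<gamma> * F x) / F x"
      using vD(1)[of x] g_nn pos by (intro divide_right_mono mult_right_mono) (auto simp: abs_minus_commute)
    also have "\<dots> = \<delta> * K x" by (simp add: K_def)
    finally have "ennreal (\<bar>F x - rv_cdf M Y x\<bar> * g (\<gamma> * F x) / F x) \<le> ennreal (\<delta> * K x)"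
      by (rule ennreal_leI)
    also have "\<dots> = f x"
      using x \<open>x \<notin> E\<close> vD(2) by (simp add: f_def ennreal_mult')
    finally show "0 < rv_cdf M X x \<and>
        ennreal (\<bar>rv_cdf M X x - rv_cdf M Y x\<bar> * g (\<gamma> * rv_cdf M X x) / rv_cdf M X x) \<le> f x"
      using pos by (simp add: F_def)
  qed
  also have "enn2real (\<integral>\<^sup>+x. f x \<partial>lborel) = \<delta> * enn2real I"
    using vD(2) by (simp add: f_int enn2real_mult)
  finally show ?thesis by (simp add: \<delta>_def F_def abs_minus_commute)
qed

text \<open>The risk is itself an integral here, so \<open>concave_distortion_diff\<close> applies
  pointwise under it and the ends of the support drop out as a null set.\<close>

lemma (in prob_space) distortion_weighted_lipschitz:
  assumes g: "distortion_function g" "concave_on {0..1} g" and \<gamma>: "0 < \<gamma>" "\<gamma> < 1"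
    and \<phi>: "weight_function \<phi>" and X: "X \<in> distortion_domain M g" and Y: "Y \<in> distortion_domain M g"
    and int: "(\<integral>\<^sup>+x\<in>supp_interior (rv_cdf M X).
        ennreal (g (\<gamma> * rv_cdf M X x) / (rv_cdf M X x * \<phi> x)) \<partial>lborel) = I" "I < \<infinity>"
    and v: "(\<lambda>x. rv_cdf M Y x - rv_cdf M X x) \<in> weighted_cadlag_supp \<phi> (rv_cdf M X)"
  shows "\<bar>distortion_risk M g Y - distortion_risk M g X\<bar>
    \<le> weighted_norm \<phi> (\<lambda>x. rv_cdf M Y x - rv_cdf M X x) * (enn2real I / (\<gamma> * (1 - \<gamma>)))"
proof -
  define F where "F = rv_cdf M X"
  define \<delta> where "\<delta> = weighted_norm \<phi> (\<lambda>x. rv_cdf M Y x - F x)"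
  define K where "K x = g (\<gamma> * F x) / (F x * \<phi> x)" for x
  define c where "c = \<delta> / (\<gamma> * (1 - \<gamma>))"
  have Xm: "X \<in> borel_measurable M" and Ym: "Y \<in> borel_measurable M"
    using X Y by (auto simp: distortion_domain_def)
  note F = rv_cdf_props[OF Xm, folded F_def]
  have "mono_on {0..1} g" using g(1) by (simp add: distortion_function_def)
  then have [measurable]: "(\<lambda>x. g (\<gamma> * F x)) \<in> borel_measurable borel"
    unfolding F_def using Xm \<gamma> by (intro borel_measurable_distortion_cdf) auto
  have [measurable]: "F \<in> borel_measurable borel" "\<phi> \<in> borel_measurable borel"
    using F(3) \<phi> by (auto intro: borel_measurable_mono borel_measurable_weight_function)
  have K[measurable]: "K \<in> borel_measurable borel" unfolding K_def by measurable
  note vD = weighted_cadlag_suppD[OF v \<phi>, folded F_def, folded \<delta>_def]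
  have c: "0 \<le> c" using vD(2) \<gamma> by (simp add: c_def)
  have "ennreal \<bar>distortion_risk M g X - distortion_risk M g Y\<bar>
      \<le> (\<integral>\<^sup>+x. ennreal \<bar>g (F x) - g (rv_cdf M Y x)\<bar> \<partial>lborel)"
    unfolding F_def by (rule distortion_risk_diff[OF g X Y])
  also have "\<dots> \<le> (\<integral>\<^sup>+x. ennreal c * (ennreal (K x) * indicator (supp_interior F) x) \<partial>lborel)"
  proof (rule nn_integral_mono_AE)
    show "AE x in lborel. ennreal \<bar>g (F x) - g (rv_cdf M Y x)\<bar>
        \<le> ennreal c * (ennreal (K x) * indicator (supp_interior F) x)"
      using AE_not_ereal_eq[of "right_inv F 0"] AE_not_ereal_eq[of "left_inv F 1"]
    proof eventually_elim
      case (elim x)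
      show ?case
      proof (cases "F x = rv_cdf M Y x")
        case False
        with vD(3)[of x] elim have x: "x \<in> supp_interior F" by auto
        then have pos: "0 < F x" by (rule supp_interior_pos[OF F(3)])
        have g_nn: "0 \<le> g (\<gamma> * F x)"
          using g(1) funcset_mem[of g "{0..1}" "{0..1}" "\<gamma> * F x"] F(1,2)[of x] \<gamma> mult_le_one[of \<gamma> "F x"]
          by (simp add: distortion_function_def)
        have "\<bar>g (F x) - g (rv_cdf M Y x)\<bar>
            \<le> \<bar>F x - rv_cdf M Y x\<bar> * g (\<gamma> * F x) / F x / (\<gamma> * (1 - \<gamma>))"
          using pos F(2) rv_cdf_props[OF Ym] by (intro concave_distortion_diff[OF g \<gamma>]) auto
        also have "\<dots> \<le> \<delta> / \<phi> x * g (\<gamma> * F x) / F x / (\<gamma> * (1 - \<gamma>))"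
          using vD(1)[of x] g_nn pos \<gamma>
          by (intro divide_right_mono mult_right_mono) (auto simp: abs_minus_commute)
        also have "\<dots> = c * K x" by (simp add: K_def c_def)
        finally show ?thesis using x c by (simp add: ennreal_mult'[symmetric] ennreal_leI)
      qed simp
    qed
  qed
  also have "\<dots> = ennreal c * I"
    unfolding int(1)[symmetric] K_def F_def[symmetric]
    by (rule nn_integral_cmult) (use K in \<open>simp add: K_def\<close>)
  also have "\<dots> = ennreal (c * enn2real I)"
    using int(2) c by (simp add: ennreal_mult')
  finally have "\<bar>distortion_risk M g X - distortion_risk M g Y\<bar> \<le> c * enn2real I"
    using c by (subst (asm) ennreal_le_iff) auto
  then show ?thesis by (simp add: c_def \<delta>_def F_def abs_minus_commute)
qed

section \<open>Law invariance of distortion risk and the pathwise conclusion\<close>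

lemma law_invariant_distortion_risk:
  assumes "\<forall>X\<in>\<X>. \<rho> X = distortion_risk M g X"
  shows "law_invariant M \<X> \<rho>"
  unfolding law_invariant_def
proof (intro ballI impI)
  fix X Y assume XY: "X \<in> \<X>" "Y \<in> \<X>" "distr M borel X = distr M borel Y"
  then have "rv_cdf M X = rv_cdf M Y" by (simp add: rv_cdf_def)
  with XY assms show "\<rho> X = \<rho> Y" by (simp add: distortion_risk_def)
qed

theorem theorem3p6:
  fixes M :: "'a measure" and \<X> :: "('a \<Rightarrow> real) set" and \<rho> :: "('a \<Rightarrow> real) \<Rightarrow> real"
    and F0 \<phi> :: "real \<Rightarrow> real"
    and M' :: "'b measure" and Fhat :: "nat \<Rightarrow> 'b \<Rightarrow> real \<Rightarrow> real" and r :: "nat \<Rightarrow> real"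
  assumes "prob_space M" and "atomless M" and "rv_space M \<X>"
    and "F0 \<in> dist_funs M \<X>" and "weight_function \<phi>"
    and A_or_B:
      "(stonean \<X> \<and> coherent M \<X> \<rho> \<and> law_invariant M \<X> \<rho> \<and>
        (\<forall>X\<in>\<X>. (AE \<omega> in M. 0 \<le> X \<omega>) \<longrightarrow>
           (\<lambda>k::nat. \<rho> (\<lambda>\<omega>. - max (X \<omega> - real k) 0)) \<longlonglongrightarrow> 0) \<and>
        (assoc_distortion M \<rho> \<longlongrightarrow> 0) (at_right 0) \<and>
        (\<exists>D. finite D \<and> F0 C1_differentiable_on (supp_interior F0 - D) \<and>
           (\<forall>x \<in> supp_interior F0 - D. deriv F0 x > 0)) \<and>
        (\<exists>\<gamma>\<in>{0<..<1}. (\<integral>\<^sup>+x\<in>supp_interior F0.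
           ennreal (assoc_distortion M \<rho> (\<gamma> * F0 x) / (F0 x * \<phi> x)) \<partial>lborel) < \<infinity>))
       \<or>
       (\<exists>g. distortion_function g \<and> continuous_on {0..1} g \<and> concave_on {0..1} g \<and>
        \<X> \<subseteq> distortion_domain M g \<and> (\<forall>X\<in>\<X>. \<rho> X = distortion_risk M g X) \<and>
        {x \<in> supp_interior F0. \<not> g differentiable (at (F0 x))} \<in> null_sets lebesgue \<and>
        (\<exists>\<gamma>\<in>{0<..<1}. (\<integral>\<^sup>+x\<in>supp_interior F0.
           ennreal (g (\<gamma> * F0 x) / (F0 x * \<phi> x)) \<partial>lborel) < \<infinity>))"
    and "prob_space M'"
    and a: "\<And>n \<omega>. \<omega> \<in> space M' \<Longrightarrow> Fhat n \<omega> \<in> dist_funs M \<X>"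
      "\<And>n. Fhat n \<in> measurable M' cadlag_measure"
    and b: "\<And>n \<omega>. \<omega> \<in> space M' \<Longrightarrow> (\<lambda>x. Fhat n \<omega> x - F0 x) \<in> weighted_cadlag_supp \<phi> F0"
    and c: "\<And>n. 0 < r n" "mono r"
      "AE \<omega> in M'. (\<lambda>n. r n * weighted_norm \<phi> (\<lambda>x. Fhat n \<omega> x - F0 x)) \<longlonglongrightarrow> 0"
  shows "AE \<omega> in M'.
    (\<lambda>n. r n * (risk_functional M \<X> \<rho> (Fhat n \<omega>) - risk_functional M \<X> \<rho> F0)) \<longlonglongrightarrow> 0"
proof -
  obtain X0 where X0: "X0 \<in> \<X>" and F0: "F0 = rv_cdf M X0"
    using assms(4) by (auto simp: dist_funs_def)
  \<comment> \<open>One constant serves all \<open>Y\<close> for the fixed \<open>X0\<close>. From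
    here on the two sets of assumptions are treated alike, and what remains is a deterministic
    estimate for each \<open>\<omega>\<close>.\<close>
  have "law_invariant M \<X> \<rho> \<and> (\<exists>C. \<forall>Y\<in>\<X>. (\<lambda>x. rv_cdf M Y x - F0 x) \<in> weighted_cadlag_supp \<phi> F0 \<longrightarrow>
      \<bar>\<rho> Y - \<rho> X0\<bar> \<le> weighted_norm \<phi> (\<lambda>x. rv_cdf M Y x - F0 x) * C)"
    using A_or_B
  proof (elim disjE)
    assume A: "stonean \<X> \<and> coherent M \<X> \<rho> \<and> law_invariant M \<X> \<rho> \<and>
        (\<forall>X\<in>\<X>. (AE \<omega> in M. 0 \<le> X \<omega>) \<longrightarrow>
           (\<lambda>k::nat. \<rho> (\<lambda>\<omega>. - max (X \<omega> - real k) 0)) \<longlonglongrightarrow> 0) \<and>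
        (assoc_distortion M \<rho> \<longlongrightarrow> 0) (at_right 0) \<and>
        (\<exists>D. finite D \<and> F0 C1_differentiable_on (supp_interior F0 - D) \<and>
           (\<forall>x \<in> supp_interior F0 - D. deriv F0 x > 0)) \<and>
        (\<exists>\<gamma>\<in>{0<..<1}. (\<integral>\<^sup>+x\<in>supp_interior F0.
           ennreal (assoc_distortion M \<rho> (\<gamma> * F0 x) / (F0 x * \<phi> x)) \<partial>lborel) < \<infinity>)"
    then interpret coherent_risk M \<X> \<rho>
      using assms(1-3) by (simp add: coherent_risk_def coherent_risk_axioms_def)
    from A obtain \<gamma> where "\<gamma> \<in> {0<..<1}" and I: "(\<integral>\<^sup>+x\<in>supp_interior F0.
           ennreal (g (\<gamma> * F0 x) / (F0 x * \<phi> x)) \<partial>lborel) < \<infinity>"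
      by (elim conjE bexE)
    then have \<gamma>: "0 < \<gamma>" "\<gamma> < 1" by auto
    have "\<bar>\<rho> Y - \<rho> X0\<bar> \<le> weighted_norm \<phi> (\<lambda>x. rv_cdf M Y x - F0 x) *
        (enn2real (\<integral>\<^sup>+x\<in>supp_interior F0. ennreal (g (\<gamma> * F0 x) / (F0 x * \<phi> x)) \<partial>lborel) / (\<gamma> * (1 - \<gamma>)))"
      if "Y \<in> \<X>" "(\<lambda>x. rv_cdf M Y x - F0 x) \<in> weighted_cadlag_supp \<phi> F0" for Y
      using that(2) I A unfolding F0
      by (elim conjE) (rule coherent_weighted_lipschitz[OF _ _ _ \<gamma> assms(5) X0 that(1) refl], assumption+)
    with A show ?thesis by blast
  next
    assume "\<exists>g. distortion_function g \<and> continuous_on {0..1} g \<and> concave_on {0..1} g \<and>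
        \<X> \<subseteq> distortion_domain M g \<and> (\<forall>X\<in>\<X>. \<rho> X = distortion_risk M g X) \<and>
        {x \<in> supp_interior F0. \<not> g differentiable (at (F0 x))} \<in> null_sets lebesgue \<and>
        (\<exists>\<gamma>\<in>{0<..<1}. (\<integral>\<^sup>+x\<in>supp_interior F0.
           ennreal (g (\<gamma> * F0 x) / (F0 x * \<phi> x)) \<partial>lborel) < \<infinity>)"
    then obtain g \<gamma> where g: "distortion_function g" "concave_on {0..1} g"
      and dom: "\<X> \<subseteq> distortion_domain M g" and \<rho>: "\<forall>X\<in>\<X>. \<rho> X = distortion_risk M g X"
      and "\<gamma> \<in> {0<..<1}" and I: "(\<integral>\<^sup>+x\<in>supp_interior F0.
           ennreal (g (\<gamma> * F0 x) / (F0 x * \<phi> x)) \<partial>lborel) < \<infinity>"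
      by (elim exE conjE bexE)
    then have \<gamma>: "0 < \<gamma>" "\<gamma> < 1" by auto
    interpret prob_space M by fact
    have "\<bar>\<rho> Y - \<rho> X0\<bar> \<le> weighted_norm \<phi> (\<lambda>x. rv_cdf M Y x - F0 x) *
        (enn2real (\<integral>\<^sup>+x\<in>supp_interior F0. ennreal (g (\<gamma> * F0 x) / (F0 x * \<phi> x)) \<partial>lborel) / (\<gamma> * (1 - \<gamma>)))"
      if "Y \<in> \<X>" "(\<lambda>x. rv_cdf M Y x - F0 x) \<in> weighted_cadlag_supp \<phi> F0" for Y
    proof -
      have "X0 \<in> distortion_domain M g" "Y \<in> distortion_domain M g" using dom X0 that by auto
      from distortion_weighted_lipschitz[OF g \<gamma> assms(5) this refl I[unfolded F0] that(2)[unfolded F0]]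
      show ?thesis using \<rho> X0 that(1) unfolding F0 by simp
    qed
    with law_invariant_distortion_risk[OF \<rho>] show ?thesis by blast
  qed
  then obtain C where law: "law_invariant M \<X> \<rho>" and C: "\<And>Y. Y \<in> \<X> \<Longrightarrow>
      (\<lambda>x. rv_cdf M Y x - F0 x) \<in> weighted_cadlag_supp \<phi> F0 \<Longrightarrow>
      \<bar>\<rho> Y - \<rho> X0\<bar> \<le> weighted_norm \<phi> (\<lambda>x. rv_cdf M Y x - F0 x) * C" by blast
  note risk = risk_functional_rv_cdf[OF assms(1,3) law]
  \<comment> \<open>\<open>AE_space\<close> supplies membership in the space, since the assumptions
    on \<open>Fhat n \<omega>\<close> are made at its points only.\<close>
  from c(3) AE_space show ?thesis
  proof eventually_elim
    case (elim \<omega>)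
    define d where "d n = r n * weighted_norm \<phi> (\<lambda>x. Fhat n \<omega> x - F0 x)" for n
    have bound: "\<bar>r n * (risk_functional M \<X> \<rho> (Fhat n \<omega>) - risk_functional M \<X> \<rho> F0)\<bar> \<le> d n * C" for n
    proof -
      obtain Y where Y: "Y \<in> \<X>" "Fhat n \<omega> = rv_cdf M Y"
        using a(1)[OF elim(2), of n] by (auto simp: dist_funs_def)
      have "\<bar>\<rho> Y - \<rho> X0\<bar> \<le> weighted_norm \<phi> (\<lambda>x. Fhat n \<omega> x - F0 x) * C"
        using C[OF Y(1)] b[OF elim(2), of n] by (simp add: Y(2))
      then have "r n * \<bar>\<rho> Y - \<rho> X0\<bar> \<le> r n * (weighted_norm \<phi> (\<lambda>x. Fhat n \<omega> x - F0 x) * C)"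
        using c(1)[of n] by (intro mult_left_mono) auto
      then show ?thesis
        using c(1)[of n] by (simp add: d_def Y(2) F0 risk[OF Y(1)] risk[OF X0] abs_mult mult.assoc)
    qed
    have lim: "(\<lambda>n. d n * C) \<longlonglongrightarrow> 0"
      using tendsto_mult_right[OF elim(1), of C] by (simp add: d_def)
    show ?case
      by (rule Lim_null_comparison[OF _ lim], unfold real_norm_def) (intro always_eventually allI bound)
  qed
qed

end
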